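(* Let $(P,\cdot,[-,-],\varepsilon,\alpha,\beta)$ be a BiHom-Poisson color algebra over a field $\mathbb{K}$ and let $\hat{\mathbb{K}}$ be an extension field of $\mathbb{K}$. Then the $G$-graded $\mathbb{K}$-vector space $$\hat{\mathbb{K}}\otimes P=\bigoplus_{g\in G}(\hat{\mathbb{K}}\otimes P)_g,\qquad (\hat{\mathbb{K}}\otimes P)_g=\hat{\mathbb{K}}\otimes P_g$$ (tensor products over $\mathbb{K}$) is a BiHom-Poisson color algebra with product $(r\otimes x)\cdot'(s\otimes y)=rs\otimes(x\cdot y)$, bracket $[r\otimes x,s\otimes y]'=rs\otimes[x,y]$, even linear maps $\alpha'(r\otimes x)=r\otimes\alpha(x)$ and $\beta'(r\otimes x)=r\otimes\beta(x)$, and the same bicharacter, i.e. $\varepsilon(r\otimes x,s\otimes y)=\varepsilon(x,y)$, for all $r,s\in\hat{\mathbb{K}}$ and all homogeneous $x,y\in P$.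
   Context: $\mathbb{K}$ is a field of characteristic different from 2 and $G$ is an abelian group (written additively). A skew-symmetric bicharacter on $G$ is a map $\varepsilon:G\times G\to\mathbb{K}^*$ with $\varepsilon(g,g')\varepsilon(g',g)=1$, $\varepsilon(g,g'+g'')=\varepsilon(g,g')\varepsilon(g,g'')$, $\varepsilon(g+g',g'')=\varepsilon(g,g'')\varepsilon(g',g'')$; $\varepsilon$ denotes such a bicharacter. For homogeneous $x,y$ of degrees $g,g'$ one writes $\varepsilon(x,y)=\varepsilon(g,g')$. A linear map is even if it preserves degrees; a bilinear map $\mu$ is even if $\mu(V_g,V_{g'})\subseteq V_{g+g'}$. A BiHom-Poisson color algebra $(P,\cdot,[-,-],\varepsilon,\alpha,\beta)$ is a $G$-graded $\mathbb{K}$-vector space $P$ with an even bilinear product $\cdot$, an even bilinear bracket $[-,-]$, and even linear maps $\alpha,\beta:P\to P$ such that $\alpha\beta=\beta\alpha$, $\alpha$ and $\beta$ are multiplicative for both the product and the bracket, and for all homogeneous $x,y,z$: - $\alpha(x)\cdot(y\cdot z)=(x\cdot y)\cdot\beta(z)$; - $[\beta(x),\alpha(y)]=-\varepsilon(x,y)[\beta(y),\alpha(x)]$; - $\oint_{x,y,z}\varepsilon(z,x)[\beta^2(x),[\beta(y),\alpha(z)]]=0$ (cyclic sum over $x,y,z$); - $[\alpha\beta(x),y\cdot z]=[\beta(x),y]\cdot\beta(z)+\varepsilon(x,y)\,\beta(y)\cdot[\alpha(x),z]$. *)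

theory Defs
  imports "HOL-Algebra.Algebra"
begin

section \<open>Linear and bilinear maps\<close>

definition linear_map ::
  "('k, 'a) ring_scheme \<Rightarrow> ('k, 'v, 'b) module_scheme \<Rightarrow> ('k, 'w, 'c) module_scheme \<Rightarrow> ('v \<Rightarrow> 'w) \<Rightarrow> bool"
  where "linear_map K V W f \<longleftrightarrow>
    f \<in> carrier V \<rightarrow> carrier W \<and>
    (\<forall>x\<in>carrier V. \<forall>y\<in>carrier V. f (x \<oplus>\<^bsub>V\<^esub> y) = f x \<oplus>\<^bsub>W\<^esub> f y) \<and>
    (\<forall>k\<in>carrier K. \<forall>x\<in>carrier V. f (k \<odot>\<^bsub>V\<^esub> x) = k \<odot>\<^bsub>W\<^esub> f x)"

definition bilinear_map ::
  "('k, 'a) ring_scheme \<Rightarrow> ('k, 'u, 'b) module_scheme \<Rightarrow> ('k, 'v, 'c) module_scheme \<Rightarrow>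
    ('k, 'w, 'd) module_scheme \<Rightarrow> ('u \<Rightarrow> 'v \<Rightarrow> 'w) \<Rightarrow> bool"
  where "bilinear_map K U V W f \<longleftrightarrow>
    (\<forall>x\<in>carrier U. linear_map K V W (f x)) \<and>
    (\<forall>y\<in>carrier V. linear_map K U W (\<lambda>x. f x y))"


section \<open>Graded vector spaces and bicharacters\<close>

text \<open>
  The grading group is a commutative group in the sense of HOL-Algebra, so its operation, written
  additively in the literature, appears here as a multiplication.  A grading is a family of
  subspaces whose internal direct sum is the whole space.
\<close>

locale graded_vector_space =
  K: field K + G: comm_group G + V: module K V
  for K :: "('k, 'a) ring_scheme" and G :: "('g, 'b) monoid_scheme"
    and V :: "('k, 'v, 'c) module_scheme" +
  fixes gr :: "'g \<Rightarrow> 'v set"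
  assumes gr_subspace: "g \<in> carrier G \<Longrightarrow> submodule (gr g) K V"
    and direct_sum: "x \<in> carrier V \<Longrightarrow>
      \<exists>!f. f \<in> (\<Pi>\<^sub>E g\<in>carrier G. gr g) \<and> finite {g \<in> carrier G. f g \<noteq> \<zero>\<^bsub>V\<^esub>} \<and>
           x = (\<Oplus>\<^bsub>V\<^esub>g\<in>{g \<in> carrier G. f g \<noteq> \<zero>\<^bsub>V\<^esub>}. f g)"

locale skew_symmetric_bicharacter =
  K: field K + G: comm_group G
  for K :: "('k, 'a) ring_scheme" and G :: "('g, 'b) monoid_scheme" +
  fixes \<epsilon> :: "'g \<Rightarrow> 'g \<Rightarrow> 'k"
  assumes bichar_closed: "\<lbrakk>g \<in> carrier G; g' \<in> carrier G\<rbrakk> \<Longrightarrow> \<epsilon> g g' \<in> Units K"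
    and bichar_skew: "\<lbrakk>g \<in> carrier G; g' \<in> carrier G\<rbrakk> \<Longrightarrow> \<epsilon> g g' \<otimes>\<^bsub>K\<^esub> \<epsilon> g' g = \<one>\<^bsub>K\<^esub>"
    and bichar_right: "\<lbrakk>g \<in> carrier G; g' \<in> carrier G; g'' \<in> carrier G\<rbrakk> \<Longrightarrow>
      \<epsilon> g (g' \<otimes>\<^bsub>G\<^esub> g'') = \<epsilon> g g' \<otimes>\<^bsub>K\<^esub> \<epsilon> g g''"
    and bichar_left: "\<lbrakk>g \<in> carrier G; g' \<in> carrier G; g'' \<in> carrier G\<rbrakk> \<Longrightarrow>
      \<epsilon> (g \<otimes>\<^bsub>G\<^esub> g') g'' = \<epsilon> g g'' \<otimes>\<^bsub>K\<^esub> \<epsilon> g' g''"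


section \<open>BiHom-Poisson color algebras\<close>

text \<open>
  Since \<open>0\<close> is homogeneous of every degree, identities involving \<open>\<epsilon>(x, y)\<close> quantify over
  degrees together with elements of those degrees.  The \<open>mult\<close> and \<open>one\<close> fields that the module
  record inherits from rings play no role; the product is the separate parameter \<open>mul\<close>.
\<close>

locale bihom_poisson_color_algebra =
  graded_vector_space K G P gr + skew_symmetric_bicharacter K G \<epsilon>
  for K :: "('k, 'a) ring_scheme" and G :: "('g, 'b) monoid_scheme"
    and P :: "('k, 'p, 'c) module_scheme" and gr :: "'g \<Rightarrow> 'p set" and \<epsilon> :: "'g \<Rightarrow> 'g \<Rightarrow> 'k" +
  fixes mul :: "'p \<Rightarrow> 'p \<Rightarrow> 'p"  (infixl \<open>\<cdot>\<close> 70)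
    and br :: "'p \<Rightarrow> 'p \<Rightarrow> 'p"
    and \<alpha> \<beta> :: "'p \<Rightarrow> 'p"
  assumes mul_bilinear: "bilinear_map K P P P (\<cdot>)"
    and br_bilinear: "bilinear_map K P P P br"
    and alpha_linear: "linear_map K P P \<alpha>"
    and beta_linear: "linear_map K P P \<beta>"
    and mul_even: "\<lbrakk>g \<in> carrier G; g' \<in> carrier G; x \<in> gr g; y \<in> gr g'\<rbrakk> \<Longrightarrow>
      x \<cdot> y \<in> gr (g \<otimes>\<^bsub>G\<^esub> g')"
    and br_even: "\<lbrakk>g \<in> carrier G; g' \<in> carrier G; x \<in> gr g; y \<in> gr g'\<rbrakk> \<Longrightarrow>
      br x y \<in> gr (g \<otimes>\<^bsub>G\<^esub> g')"
    and alpha_even: "\<lbrakk>g \<in> carrier G; x \<in> gr g\<rbrakk> \<Longrightarrow> \<alpha> x \<in> gr g"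
    and beta_even: "\<lbrakk>g \<in> carrier G; x \<in> gr g\<rbrakk> \<Longrightarrow> \<beta> x \<in> gr g"
    and alpha_beta_commute: "x \<in> carrier P \<Longrightarrow> \<alpha> (\<beta> x) = \<beta> (\<alpha> x)"
    and alpha_mul: "\<lbrakk>x \<in> carrier P; y \<in> carrier P\<rbrakk> \<Longrightarrow> \<alpha> (x \<cdot> y) = \<alpha> x \<cdot> \<alpha> y"
    and beta_mul: "\<lbrakk>x \<in> carrier P; y \<in> carrier P\<rbrakk> \<Longrightarrow> \<beta> (x \<cdot> y) = \<beta> x \<cdot> \<beta> y"
    and alpha_br: "\<lbrakk>x \<in> carrier P; y \<in> carrier P\<rbrakk> \<Longrightarrow> \<alpha> (br x y) = br (\<alpha> x) (\<alpha> y)"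
    and beta_br: "\<lbrakk>x \<in> carrier P; y \<in> carrier P\<rbrakk> \<Longrightarrow> \<beta> (br x y) = br (\<beta> x) (\<beta> y)"
    and bihom_assoc:
      "\<lbrakk>g \<in> carrier G; g' \<in> carrier G; g'' \<in> carrier G; x \<in> gr g; y \<in> gr g'; z \<in> gr g''\<rbrakk> \<Longrightarrow>
      \<alpha> x \<cdot> (y \<cdot> z) = (x \<cdot> y) \<cdot> \<beta> z"
    and bihom_skew:
      "\<lbrakk>g \<in> carrier G; g' \<in> carrier G; x \<in> gr g; y \<in> gr g'\<rbrakk> \<Longrightarrow>
      br (\<beta> x) (\<alpha> y) = \<ominus>\<^bsub>P\<^esub> (\<epsilon> g g' \<odot>\<^bsub>P\<^esub> br (\<beta> y) (\<alpha> x))"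
    and bihom_jacobi:
      "\<lbrakk>g \<in> carrier G; g' \<in> carrier G; g'' \<in> carrier G; x \<in> gr g; y \<in> gr g'; z \<in> gr g''\<rbrakk> \<Longrightarrow>
      \<epsilon> g'' g \<odot>\<^bsub>P\<^esub> br (\<beta> (\<beta> x)) (br (\<beta> y) (\<alpha> z)) \<oplus>\<^bsub>P\<^esub>
      \<epsilon> g g' \<odot>\<^bsub>P\<^esub> br (\<beta> (\<beta> y)) (br (\<beta> z) (\<alpha> x)) \<oplus>\<^bsub>P\<^esub>
      \<epsilon> g' g'' \<odot>\<^bsub>P\<^esub> br (\<beta> (\<beta> z)) (br (\<beta> x) (\<alpha> y)) = \<zero>\<^bsub>P\<^esub>"
    and bihom_leibniz:
      "\<lbrakk>g \<in> carrier G; g' \<in> carrier G; g'' \<in> carrier G; x \<in> gr g; y \<in> gr g'; z \<in> gr g''\<rbrakk> \<Longrightarrow>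
      br (\<alpha> (\<beta> x)) (y \<cdot> z) = (br (\<beta> x) y \<cdot> \<beta> z) \<oplus>\<^bsub>P\<^esub> (\<epsilon> g g' \<odot>\<^bsub>P\<^esub> (\<beta> y \<cdot> br (\<alpha> x) z))"


section \<open>Tensor products\<close>

text \<open>
  \<open>V \<otimes> W\<close> is the quotient of the free abelian group on \<open>V \<times> W\<close> by the subgroup generated by the
  relations of biadditivity and \<open>K\<close>-balancedness.
\<close>

definition tensor_relations ::
  "('k, 'a) ring_scheme \<Rightarrow> ('k, 'v, 'b) module_scheme \<Rightarrow> ('k, 'w, 'c) module_scheme \<Rightarrow> ('v \<times> 'w \<Rightarrow>\<^sub>0 int) set"
  where "tensor_relations K V W =
    {frag_of (v \<oplus>\<^bsub>V\<^esub> v', w) - frag_of (v, w) - frag_of (v', w) |v v' w.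
       v \<in> carrier V \<and> v' \<in> carrier V \<and> w \<in> carrier W} \<union>
    {frag_of (v, w \<oplus>\<^bsub>W\<^esub> w') - frag_of (v, w) - frag_of (v, w') |v w w'.
       v \<in> carrier V \<and> w \<in> carrier W \<and> w' \<in> carrier W} \<union>
    {frag_of (k \<odot>\<^bsub>V\<^esub> v, w) - frag_of (v, k \<odot>\<^bsub>W\<^esub> w) |k v w.
       k \<in> carrier K \<and> v \<in> carrier V \<and> w \<in> carrier W}"

abbreviation tensor_free ::
  "('k, 'v, 'b) module_scheme \<Rightarrow> ('k, 'w, 'c) module_scheme \<Rightarrow> ('v \<times> 'w \<Rightarrow>\<^sub>0 int) monoid"
  where "tensor_free V W \<equiv> free_Abelian_group (carrier V \<times> carrier W)"

definition tensor_null ::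
  "('k, 'a) ring_scheme \<Rightarrow> ('k, 'v, 'b) module_scheme \<Rightarrow> ('k, 'w, 'c) module_scheme \<Rightarrow> ('v \<times> 'w \<Rightarrow>\<^sub>0 int) set"
  where "tensor_null K V W = generate (tensor_free V W) (tensor_relations K V W)"

text \<open>
  The scalar \<open>k\<close> acts through the endomorphism \<open>(v, w) \<mapsto> (k v, w)\<close> of the free group; the image of
  a coset under it lies in a single coset, which is recovered by adding the null subgroup.
  The ring fields \<open>mult\<close> and \<open>one\<close> of the module record carry no meaning.
\<close>

definition tensor_product ::
  "('k, 'a) ring_scheme \<Rightarrow> ('k, 'v, 'b) module_scheme \<Rightarrow> ('k, 'w, 'c) module_scheme \<Rightarrow>
    ('k, ('v \<times> 'w \<Rightarrow>\<^sub>0 int) set) module"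
  where "tensor_product K V W =
    (let F = tensor_free V W; N = tensor_null K V W in
     \<lparr>carrier = carrier (F Mod N), monoid.mult = undefined, one = undefined,
      ring.zero = \<one>\<^bsub>F Mod N\<^esub>, ring.add = (\<otimes>\<^bsub>F Mod N\<^esub>),
      smult = (\<lambda>k U. N <#>\<^bsub>F\<^esub> (frag_extend (\<lambda>(v, w). frag_of (k \<odot>\<^bsub>V\<^esub> v, w)) ` U))\<rparr>)"

definition pure_tensor ::
  "('k, 'a) ring_scheme \<Rightarrow> ('k, 'v, 'b) module_scheme \<Rightarrow> ('k, 'w, 'c) module_scheme \<Rightarrow>
    'v \<Rightarrow> 'w \<Rightarrow> ('v \<times> 'w \<Rightarrow>\<^sub>0 int) set"
  where "pure_tensor K V W v w = tensor_null K V W #>\<^bsub>tensor_free V W\<^esub> frag_of (v, w)"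

text \<open>\<open>V \<otimes> S\<close> for a subspace \<open>S\<close> of \<open>W\<close>, regarded as a subspace of \<open>V \<otimes> W\<close>.\<close>

definition tensor_subspace ::
  "('k, 'a) ring_scheme \<Rightarrow> ('k, 'v, 'b) module_scheme \<Rightarrow> ('k, 'w, 'c) module_scheme \<Rightarrow>
    'w set \<Rightarrow> ('v \<times> 'w \<Rightarrow>\<^sub>0 int) set set"
  where "tensor_subspace K V W S =
    generate (add_monoid (tensor_product K V W)) {pure_tensor K V W v w |v w. v \<in> carrier V \<and> w \<in> S}"


section \<open>Extension of scalars\<close>

text \<open>The extension field \<open>L\<close> as a vector space over \<open>K\<close>, via the embedding \<open>h\<close> of \<open>K\<close> into \<open>L\<close>.\<close>

definition restrict_scalars :: "('l, 'a) ring_scheme \<Rightarrow> ('k \<Rightarrow> 'l) \<Rightarrow> ('k, 'l) module"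
  where "restrict_scalars L h =
    \<lparr>carrier = carrier L, monoid.mult = (\<otimes>\<^bsub>L\<^esub>), one = \<one>\<^bsub>L\<^esub>, ring.zero = \<zero>\<^bsub>L\<^esub>, ring.add = (\<oplus>\<^bsub>L\<^esub>),
     smult = (\<lambda>k r. h k \<otimes>\<^bsub>L\<^esub> r)\<rparr>"

abbreviation scalar_extension ::
  "('k, 'a) ring_scheme \<Rightarrow> ('l, 'b) ring_scheme \<Rightarrow> ('k \<Rightarrow> 'l) \<Rightarrow> ('k, 'p, 'c) module_scheme \<Rightarrow>
    ('k, ('l \<times> 'p \<Rightarrow>\<^sub>0 int) set) module"
  where "scalar_extension K L h P \<equiv> tensor_product K (restrict_scalars L h) P"

abbreviation ext_tensor ::
  "('k, 'a) ring_scheme \<Rightarrow> ('l, 'b) ring_scheme \<Rightarrow> ('k \<Rightarrow> 'l) \<Rightarrow> ('k, 'p, 'c) module_scheme \<Rightarrow>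
    'l \<Rightarrow> 'p \<Rightarrow> ('l \<times> 'p \<Rightarrow>\<^sub>0 int) set"
  where "ext_tensor K L h P \<equiv> pure_tensor K (restrict_scalars L h) P"

abbreviation ext_grading ::
  "('k, 'a) ring_scheme \<Rightarrow> ('l, 'b) ring_scheme \<Rightarrow> ('k \<Rightarrow> 'l) \<Rightarrow> ('k, 'p, 'c) module_scheme \<Rightarrow>
    ('g \<Rightarrow> 'p set) \<Rightarrow> 'g \<Rightarrow> ('l \<times> 'p \<Rightarrow>\<^sub>0 int) set set"
  where "ext_grading K L h P gr g \<equiv> tensor_subspace K (restrict_scalars L h) P (gr g)"

text \<open>
  The (bi)linear operations on the scalar extension prescribed on tensors \<open>r \<otimes> x\<close> with \<open>x\<close>
  homogeneous.
\<close>

definition extended_operations ::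
  "('k, 'a) ring_scheme \<Rightarrow> ('l, 'b) ring_scheme \<Rightarrow> ('k \<Rightarrow> 'l) \<Rightarrow> ('g, 'c) monoid_scheme \<Rightarrow>
    ('k, 'p, 'd) module_scheme \<Rightarrow> ('g \<Rightarrow> 'p set) \<Rightarrow>
    ('p \<Rightarrow> 'p \<Rightarrow> 'p) \<Rightarrow> ('p \<Rightarrow> 'p \<Rightarrow> 'p) \<Rightarrow> ('p \<Rightarrow> 'p) \<Rightarrow> ('p \<Rightarrow> 'p) \<Rightarrow>
    (('l \<times> 'p \<Rightarrow>\<^sub>0 int) set \<Rightarrow> ('l \<times> 'p \<Rightarrow>\<^sub>0 int) set \<Rightarrow> ('l \<times> 'p \<Rightarrow>\<^sub>0 int) set) \<Rightarrow>
    (('l \<times> 'p \<Rightarrow>\<^sub>0 int) set \<Rightarrow> ('l \<times> 'p \<Rightarrow>\<^sub>0 int) set \<Rightarrow> ('l \<times> 'p \<Rightarrow>\<^sub>0 int) set) \<Rightarrow>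
    (('l \<times> 'p \<Rightarrow>\<^sub>0 int) set \<Rightarrow> ('l \<times> 'p \<Rightarrow>\<^sub>0 int) set) \<Rightarrow>
    (('l \<times> 'p \<Rightarrow>\<^sub>0 int) set \<Rightarrow> ('l \<times> 'p \<Rightarrow>\<^sub>0 int) set) \<Rightarrow> bool"
  where "extended_operations K L h G P gr mul br \<alpha> \<beta> mul' br' \<alpha>' \<beta>' \<longleftrightarrow>
    (let T = scalar_extension K L h P; t = ext_tensor K L h P in
      bilinear_map K T T T mul' \<and> bilinear_map K T T T br' \<and>
      linear_map K T T \<alpha>' \<and> linear_map K T T \<beta>' \<and>
      (\<forall>r\<in>carrier L. \<forall>s\<in>carrier L. \<forall>g\<in>carrier G. \<forall>g'\<in>carrier G. \<forall>x\<in>gr g. \<forall>y\<in>gr g'.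
        mul' (t r x) (t s y) = t (r \<otimes>\<^bsub>L\<^esub> s) (mul x y) \<and>
        br' (t r x) (t s y) = t (r \<otimes>\<^bsub>L\<^esub> s) (br x y)) \<and>
      (\<forall>r\<in>carrier L. \<forall>g\<in>carrier G. \<forall>x\<in>gr g.
        \<alpha>' (t r x) = t r (\<alpha> x) \<and> \<beta>' (t r x) = t r (\<beta> x)))"

end

theory Submission
  imports Defs
begin

text \<open>
  The statement is an instance of a more general one: if \<open>V\<close> is a commutative associative algebra over
  \<open>K\<close> and \<open>P\<close> a BiHom-Poisson color algebra over \<open>K\<close>, then \<open>V \<otimes> P\<close> is a BiHom-Poisson color algebra
  (\<open>tensor_bihom_poisson_color_algebra\<close>).  Since all operations are multilinear, every axiom, be it an
  identity or a condition on degrees, can be tested on pure tensors \<open>a \<otimes> x\<close>.  There the coefficients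
  from \<open>V\<close> collect into one common product, because \<open>V\<close> is commutative and associative, and what
  remains is the same axiom in \<open>P\<close>.  The extension field, with scalars restricted to \<open>K\<close>, is such a
  \<open>V\<close>.

  The substance lies in the tensor product.  Its universal property (\<open>tensor_universal\<close>) yields
  the extensions of linear maps and, applied twice, of bilinear operations
  (\<open>tensor_linear_map\<close>, \<open>tensor_bilinear_map\<close>).  These extensions are unique because the tensors
  \<open>r \<otimes> x\<close> with \<open>x\<close> homogeneous span the tensor product (\<open>linear_map_eq_on_homogeneous_pure\<close>).

  The grading is treated through its projections \<open>p g\<close>.  The maps \<open>id \<otimes> p g\<close> are projections onto the
  subspaces spanned by the tensors \<open>r \<otimes> x\<close> with \<open>x\<close> of degree \<open>g\<close>, so these subspaces form a grading
  (\<open>tensor_grading\<close>).  The same maps are left inverses of the natural maps from the tensor products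
  with the components of \<open>P\<close>, which identifies those tensor products with the graded parts
  (\<open>tensor_of_summand\<close>).
\<close>

section \<open>Linear and bilinear maps\<close>

lemma linear_map_closed: "linear_map K V W f \<Longrightarrow> x \<in> carrier V \<Longrightarrow> f x \<in> carrier W"
  unfolding linear_map_def by auto

lemma linear_map_add:
  "linear_map K V W f \<Longrightarrow> x \<in> carrier V \<Longrightarrow> y \<in> carrier V \<Longrightarrow> f (x \<oplus>\<^bsub>V\<^esub> y) = f x \<oplus>\<^bsub>W\<^esub> f y"
  unfolding linear_map_def by auto

lemma linear_map_smult:
  "linear_map K V W f \<Longrightarrow> k \<in> carrier K \<Longrightarrow> x \<in> carrier V \<Longrightarrow> f (k \<odot>\<^bsub>V\<^esub> x) = k \<odot>\<^bsub>W\<^esub> f x"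
  unfolding linear_map_def by auto

lemma linear_map_group_hom:
  assumes "abelian_group V" and "abelian_group W" and "linear_map K V W f"
  shows "group_hom (add_monoid V) (add_monoid W) f"
  using assms unfolding linear_map_def group_hom_def group_hom_axioms_def
  by (auto simp: hom_def abelian_group.a_group)

lemma linear_map_zero:
  assumes "abelian_group V" and "abelian_group W" and "linear_map K V W f"
  shows "f \<zero>\<^bsub>V\<^esub> = \<zero>\<^bsub>W\<^esub>"
  using group_hom.hom_one[OF linear_map_group_hom[OF assms]] by simp

lemma linear_map_minus:
  assumes "abelian_group V" and "abelian_group W" and "linear_map K V W f" and "x \<in> carrier V"
  shows "f (\<ominus>\<^bsub>V\<^esub> x) = \<ominus>\<^bsub>W\<^esub> f x"
  using group_hom.hom_inv[OF linear_map_group_hom[OF assms(1-3)]] assms(4) by (simp add: a_inv_def)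

lemma linear_map_finsum:
  assumes "abelian_group V" and "abelian_group W" and f: "linear_map K V W f"
    and "finite A" and "h \<in> A \<rightarrow> carrier V"
  shows "f (\<Oplus>\<^bsub>V\<^esub>a\<in>A. h a) = (\<Oplus>\<^bsub>W\<^esub>a\<in>A. f (h a))"
proof -
  interpret V: abelian_group V by fact
  interpret W: abelian_group W by fact
  show ?thesis
    using \<open>finite A\<close> \<open>h \<in> A \<rightarrow> carrier V\<close>
  proof (induction A)
    case empty
    then show ?case by (simp add: linear_map_zero[OF assms(1-3)])
  next
    case (insert a A)
    then have "(\<lambda>a. f (h a)) \<in> A \<rightarrow> carrier W"
      by (auto intro: linear_map_closed[OF f])
    with insert show ?case
      by (simp add: Pi_iff linear_map_add[OF f] linear_map_closed[OF f])
  qed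
qed

lemma bilinear_map_linear:
  assumes "bilinear_map K U V W f"
  shows "x \<in> carrier U \<Longrightarrow> linear_map K V W (f x)"
    and "y \<in> carrier V \<Longrightarrow> linear_map K U W (\<lambda>x. f x y)"
  using assms unfolding bilinear_map_def by auto

lemma bilinear_map_simps:
  assumes "bilinear_map K U V W f"
  shows "x \<in> carrier U \<Longrightarrow> y \<in> carrier V \<Longrightarrow> f x y \<in> carrier W"
    and "x \<in> carrier U \<Longrightarrow> y \<in> carrier V \<Longrightarrow> y' \<in> carrier V \<Longrightarrow> f x (y \<oplus>\<^bsub>V\<^esub> y') = f x y \<oplus>\<^bsub>W\<^esub> f x y'"
    and "x \<in> carrier U \<Longrightarrow> x' \<in> carrier U \<Longrightarrow> y \<in> carrier V \<Longrightarrow> f (x \<oplus>\<^bsub>U\<^esub> x') y = f x y \<oplus>\<^bsub>W\<^esub> f x' y"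
    and "k \<in> carrier K \<Longrightarrow> x \<in> carrier U \<Longrightarrow> y \<in> carrier V \<Longrightarrow> f x (k \<odot>\<^bsub>V\<^esub> y) = k \<odot>\<^bsub>W\<^esub> f x y"
    and "k \<in> carrier K \<Longrightarrow> x \<in> carrier U \<Longrightarrow> y \<in> carrier V \<Longrightarrow> f (k \<odot>\<^bsub>U\<^esub> x) y = k \<odot>\<^bsub>W\<^esub> f x y"
  using assms unfolding bilinear_map_def linear_map_def by auto

lemma bilinear_map_zero:
  assumes "abelian_group U" "abelian_group V" "abelian_group W" and f: "bilinear_map K U V W f"
  shows "x \<in> carrier U \<Longrightarrow> f x \<zero>\<^bsub>V\<^esub> = \<zero>\<^bsub>W\<^esub>"
    and "y \<in> carrier V \<Longrightarrow> f \<zero>\<^bsub>U\<^esub> y = \<zero>\<^bsub>W\<^esub>"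
  using linear_map_zero[OF _ _ bilinear_map_linear(1)[OF f]]
    linear_map_zero[OF _ _ bilinear_map_linear(2)[OF f]] assms
  by auto

lemma bilinear_mapI:
  assumes "\<And>x y. x \<in> carrier U \<Longrightarrow> y \<in> carrier V \<Longrightarrow> f x y \<in> carrier W"
    and "\<And>x y y'. x \<in> carrier U \<Longrightarrow> y \<in> carrier V \<Longrightarrow> y' \<in> carrier V \<Longrightarrow> f x (y \<oplus>\<^bsub>V\<^esub> y') = f x y \<oplus>\<^bsub>W\<^esub> f x y'"
    and "\<And>x x' y. x \<in> carrier U \<Longrightarrow> x' \<in> carrier U \<Longrightarrow> y \<in> carrier V \<Longrightarrow> f (x \<oplus>\<^bsub>U\<^esub> x') y = f x y \<oplus>\<^bsub>W\<^esub> f x' y"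
    and "\<And>k x y. k \<in> carrier K \<Longrightarrow> x \<in> carrier U \<Longrightarrow> y \<in> carrier V \<Longrightarrow> f x (k \<odot>\<^bsub>V\<^esub> y) = k \<odot>\<^bsub>W\<^esub> f x y"
    and "\<And>k x y. k \<in> carrier K \<Longrightarrow> x \<in> carrier U \<Longrightarrow> y \<in> carrier V \<Longrightarrow> f (k \<odot>\<^bsub>U\<^esub> x) y = k \<odot>\<^bsub>W\<^esub> f x y"
  shows "bilinear_map K U V W f"
  using assms unfolding bilinear_map_def linear_map_def by auto

section \<open>The tensor product of two modules\<close>

locale module_pair = V: module K V + W: module K W
  for K :: "('k, 'a) ring_scheme" and V :: "('k, 'v, 'b) module_scheme"
    and W :: "('k, 'w, 'c) module_scheme"
begin

abbreviation F where "F \<equiv> tensor_free V W"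
abbreviation N where "N \<equiv> tensor_null K V W"
abbreviation T where "T \<equiv> tensor_product K V W"
abbreviation t where "t \<equiv> pure_tensor K V W"
abbreviation scale where "scale k \<equiv> frag_extend (\<lambda>(v, w). frag_of (k \<odot>\<^bsub>V\<^esub> v, w))"

sublocale F: comm_group F
  by (rule abelian_free_Abelian_group)

lemma tensor_relationsI:
  shows "v \<in> carrier V \<Longrightarrow> v' \<in> carrier V \<Longrightarrow> w \<in> carrier W \<Longrightarrow>
      frag_of (v \<oplus>\<^bsub>V\<^esub> v', w) - frag_of (v, w) - frag_of (v', w) \<in> tensor_relations K V W"
    and "v \<in> carrier V \<Longrightarrow> w \<in> carrier W \<Longrightarrow> w' \<in> carrier W \<Longrightarrow>
      frag_of (v, w \<oplus>\<^bsub>W\<^esub> w') - frag_of (v, w) - frag_of (v, w') \<in> tensor_relations K V W"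
    and "k \<in> carrier K \<Longrightarrow> v \<in> carrier V \<Longrightarrow> w \<in> carrier W \<Longrightarrow>
      frag_of (k \<odot>\<^bsub>V\<^esub> v, w) - frag_of (v, k \<odot>\<^bsub>W\<^esub> w) \<in> tensor_relations K V W"
  unfolding tensor_relations_def by blast+

lemma tensor_relationsE:
  assumes "c \<in> tensor_relations K V W"
  obtains (left) v v' w where "v \<in> carrier V" "v' \<in> carrier V" "w \<in> carrier W"
      "c = frag_of (v \<oplus>\<^bsub>V\<^esub> v', w) - frag_of (v, w) - frag_of (v', w)"
    | (right) v w w' where "v \<in> carrier V" "w \<in> carrier W" "w' \<in> carrier W"
      "c = frag_of (v, w \<oplus>\<^bsub>W\<^esub> w') - frag_of (v, w) - frag_of (v, w')"
    | (scalar) k v w where "k \<in> carrier K" "v \<in> carrier V" "w \<in> carrier W"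
      "c = frag_of (k \<odot>\<^bsub>V\<^esub> v, w) - frag_of (v, k \<odot>\<^bsub>W\<^esub> w)"
proof -
  show thesis
    using assms unfolding tensor_relations_def
    by (elim UnE CollectE exE conjE) (rule left right scalar; assumption)+
qed

lemma frag_of_free: "v \<in> carrier V \<Longrightarrow> w \<in> carrier W \<Longrightarrow> frag_of (v, w) \<in> carrier F"
  by simp

lemma diff_free: "a \<in> carrier F \<Longrightarrow> b \<in> carrier F \<Longrightarrow> a - b \<in> carrier F"
  using keys_diff by fastforce

lemma tensor_relations_carrier: "tensor_relations K V W \<subseteq> carrier F"
  by (rule subsetI, erule tensor_relationsE)
    (simp_all add: diff_free frag_of_free del: carrier_free_Abelian_group_iff)

lemma null_subgroup: "subgroup N F"
  unfolding tensor_null_def by (rule F.generate_is_subgroup[OF tensor_relations_carrier])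

lemma null_normal: "N \<lhd> F"
  by (rule F.subgroup_imp_normal[OF null_subgroup])

lemma null_add: "a \<in> N \<Longrightarrow> b \<in> N \<Longrightarrow> a + b \<in> N"
  using subgroup.m_closed[OF null_subgroup] by simp

lemma tensor_relations_null: "a \<in> tensor_relations K V W \<Longrightarrow> a \<in> N"
  unfolding tensor_null_def by (rule generate.incl)

definition coset :: "('v \<times> 'w \<Rightarrow>\<^sub>0 int) \<Rightarrow> ('v \<times> 'w \<Rightarrow>\<^sub>0 int) set"
  where "coset c = N #>\<^bsub>F\<^esub> c"

lemma pure_tensor_coset: "t v w = coset (frag_of (v, w))"
  unfolding pure_tensor_def coset_def ..

lemma tensor_carrier: "carrier T = coset ` carrier F"
  unfolding tensor_product_def Let_def coset_def by (simp add: carrier_FactGroup)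

lemma coset_zero: "coset 0 = \<zero>\<^bsub>T\<^esub>"
  using F.coset_join2[OF F.one_closed null_subgroup] subgroup.one_closed[OF null_subgroup]
  unfolding tensor_product_def Let_def coset_def by simp

lemma coset_add:
  "a \<in> carrier F \<Longrightarrow> b \<in> carrier F \<Longrightarrow> coset a \<oplus>\<^bsub>T\<^esub> coset b = coset (a + b)"
  using normal.rcos_sum[OF null_normal, of a b]
  unfolding tensor_product_def Let_def coset_def by simp

lemma coset_eqI:
  assumes "a \<in> carrier F" "b \<in> carrier F" "a - b \<in> N"
  shows "coset a = coset b"
proof -
  have "a \<in> N #>\<^bsub>F\<^esub> b"
    using subgroup.rcos_module[OF null_subgroup F.group_axioms assms(2,1)] assms by simp
  then show ?thesis
    unfolding coset_def using F.repr_independence[OF _ assms(2) null_subgroup] by simp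
qed

lemma scale_carrier:
  "k \<in> carrier K \<Longrightarrow> c \<in> carrier F \<Longrightarrow> scale k c \<in> carrier F"
  using keys_frag_extend[of "\<lambda>(v, w). frag_of (k \<odot>\<^bsub>V\<^esub> v, w)" c]
  by (fastforce split: prod.splits)

text \<open>
  Multiplying the first components by a scalar sends each of the three kinds of defining relations
  to a relation of the same kind (for balancedness because scalars commute), hence preserves the
  null subgroup.
\<close>

lemma scale_null:
  assumes k: "k \<in> carrier K" and c: "c \<in> N"
  shows "scale k c \<in> N"
proof -
  have rel: "scale k c \<in> N" if "c \<in> tensor_relations K V W" for c
  proof (rule tensor_relations_null)
    show "scale k c \<in> tensor_relations K V W"
      using that
    proof (cases rule: tensor_relationsE)
      case (left v v' w)
      with k show ?thesis
        using tensor_relationsI(1)[of "k \<odot>\<^bsub>V\<^esub> v" "k \<odot>\<^bsub>V\<^esub> v'" w]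
        by (simp add: frag_extend_diff V.smult_r_distr)
    next
      case (right v w w')
      with k show ?thesis
        using tensor_relationsI(2)[of "k \<odot>\<^bsub>V\<^esub> v" w w'] by (simp add: frag_extend_diff)
    next
      case (scalar l v w)
      then have "k \<odot>\<^bsub>V\<^esub> (l \<odot>\<^bsub>V\<^esub> v) = l \<odot>\<^bsub>V\<^esub> (k \<odot>\<^bsub>V\<^esub> v)"
        using k by (simp add: V.smult_assoc1[symmetric] V.R.m_comm)
      with scalar k show ?thesis
        using tensor_relationsI(3)[of l "k \<odot>\<^bsub>V\<^esub> v" w] by (simp add: frag_extend_diff)
    qed
  qed
  have "scale k c \<in> N" if "c \<in> generate F (tensor_relations K V W)"
    using that
  proof (induction c)
    case one
    then show ?case using subgroup.one_closed[OF null_subgroup] by simp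
  next
    case (incl h)
    then show ?case by (rule rel)
  next
    case (inv h)
    then have h: "Poly_Mapping.keys h \<subseteq> carrier V \<times> carrier W"
      using subsetD[OF tensor_relations_carrier inv] by simp
    have "scale k h \<in> carrier F"
      using scale_carrier[OF k] h by simp
    then have "- scale k h \<in> N"
      using subgroup.m_inv_closed[OF null_subgroup rel[OF inv]] by simp
    with h show ?case by (simp add: frag_extend_minus)
  next
    case (eng a b)
    then show ?case by (simp add: frag_extend_add null_add)
  qed
  then show ?thesis
    using c unfolding tensor_null_def by simp
qed

text \<open>
  The scalar action on cosets is therefore the one induced by the action on representatives; all
  module axioms reduce to pure tensors through this formula.
\<close>

lemma smult_coset:
  assumes k: "k \<in> carrier K" and c: "c \<in> carrier F"
  shows "k \<odot>\<^bsub>T\<^esub> coset c = coset (scale k c)"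
proof -
  have zero: "0 \<in> N"
    using subgroup.one_closed[OF null_subgroup] by simp
  have "k \<odot>\<^bsub>T\<^esub> coset c = N <#>\<^bsub>F\<^esub> (scale k ` coset c)"
    unfolding tensor_product_def Let_def by simp
  also have "\<dots> = coset (scale k c)"
  proof (intro equalityI subsetI)
    fix x assume "x \<in> N <#>\<^bsub>F\<^esub> (scale k ` coset c)"
    then obtain m n where mn: "m \<in> N" "n \<in> N" and x: "x = m + scale k (n + c)"
      unfolding coset_def r_coset_def set_mult_def by auto
    have "x = (m + scale k n) + scale k c"
      unfolding x by (simp add: frag_extend_add)
    moreover have "m + scale k n \<in> N"
      by (intro null_add scale_null k mn)
    ultimately show "x \<in> coset (scale k c)"
      unfolding coset_def r_coset_def by auto
  next
    fix x assume "x \<in> coset (scale k c)"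
    then obtain n where n: "n \<in> N" and x: "x = n + scale k c"
      unfolding coset_def r_coset_def by auto
    have "c \<in> coset c"
      using zero unfolding coset_def r_coset_def by force
    then show "x \<in> N <#>\<^bsub>F\<^esub> (scale k ` coset c)"
      using n unfolding x set_mult_def by auto
  qed
  finally show ?thesis .
qed

lemma pure_closed [simp, intro]: "v \<in> carrier V \<Longrightarrow> w \<in> carrier W \<Longrightarrow> t v w \<in> carrier T"
  unfolding pure_tensor_coset tensor_carrier by auto

lemma smult_pure:
  "k \<in> carrier K \<Longrightarrow> v \<in> carrier V \<Longrightarrow> w \<in> carrier W \<Longrightarrow> k \<odot>\<^bsub>T\<^esub> t v w = t (k \<odot>\<^bsub>V\<^esub> v) w"
  unfolding pure_tensor_coset by (simp add: smult_coset)

lemma pure_balanced: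
  assumes "k \<in> carrier K" "v \<in> carrier V" "w \<in> carrier W"
  shows "t (k \<odot>\<^bsub>V\<^esub> v) w = t v (k \<odot>\<^bsub>W\<^esub> w)"
  unfolding pure_tensor_coset
proof (rule coset_eqI)
  show "frag_of (k \<odot>\<^bsub>V\<^esub> v, w) - frag_of (v, k \<odot>\<^bsub>W\<^esub> w) \<in> N"
    by (intro tensor_relations_null tensor_relationsI assms)
qed (use assms in auto)

lemma pure_add_left:
  assumes "v \<in> carrier V" "v' \<in> carrier V" "w \<in> carrier W"
  shows "t (v \<oplus>\<^bsub>V\<^esub> v') w = t v w \<oplus>\<^bsub>T\<^esub> t v' w"
proof -
  have "coset (frag_of (v \<oplus>\<^bsub>V\<^esub> v', w)) = coset (frag_of (v, w) + frag_of (v', w))"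
  proof (rule coset_eqI)
    show "frag_of (v \<oplus>\<^bsub>V\<^esub> v', w) - (frag_of (v, w) + frag_of (v', w)) \<in> N"
      using tensor_relations_null[OF tensor_relationsI(1)[OF assms]] by (simp add: diff_diff_eq)
    show "frag_of (v, w) + frag_of (v', w) \<in> carrier F"
      using F.m_closed[of "frag_of (v, w)" "frag_of (v', w)"] assms by simp
  qed (use assms in auto)
  with assms show ?thesis
    unfolding pure_tensor_coset by (simp add: coset_add)
qed

lemma pure_add_right:
  assumes "v \<in> carrier V" "w \<in> carrier W" "w' \<in> carrier W"
  shows "t v (w \<oplus>\<^bsub>W\<^esub> w') = t v w \<oplus>\<^bsub>T\<^esub> t v w'"
proof -
  have "coset (frag_of (v, w \<oplus>\<^bsub>W\<^esub> w')) = coset (frag_of (v, w) + frag_of (v, w'))"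
  proof (rule coset_eqI)
    show "frag_of (v, w \<oplus>\<^bsub>W\<^esub> w') - (frag_of (v, w) + frag_of (v, w')) \<in> N"
      using tensor_relations_null[OF tensor_relationsI(2)[OF assms]] by (simp add: diff_diff_eq)
    show "frag_of (v, w) + frag_of (v, w') \<in> carrier F"
      using F.m_closed[of "frag_of (v, w)" "frag_of (v, w')"] assms by simp
  qed (use assms in auto)
  with assms show ?thesis
    unfolding pure_tensor_coset by (simp add: coset_add)
qed

lemma tensor_quotient:
  "carrier T = carrier (F Mod N)" "add T = monoid.mult (F Mod N)" "\<zero>\<^bsub>T\<^esub> = \<one>\<^bsub>F Mod N\<^esub>"
  unfolding tensor_product_def Let_def by simp_all

lemma tensor_abelian_group: "abelian_group T"
proof -
  interpret Q: comm_group "F Mod N"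
    by (rule F.abelian_FactGroup[OF null_subgroup])
  show ?thesis
    by (rule abelian_groupI, unfold tensor_quotient)
      (rule Q.m_closed Q.one_closed Q.m_assoc Q.m_comm Q.l_one Q.l_inv_ex; assumption)+
qed

sublocale T: abelian_group T
  by (rule tensor_abelian_group)

lemma pure_zero_right: "v \<in> carrier V \<Longrightarrow> t v \<zero>\<^bsub>W\<^esub> = \<zero>\<^bsub>T\<^esub>"
  using pure_add_right[of v "\<zero>\<^bsub>W\<^esub>" "\<zero>\<^bsub>W\<^esub>"] T.add.l_cancel_one' by fastforce

lemma pure_zero_left: "w \<in> carrier W \<Longrightarrow> t \<zero>\<^bsub>V\<^esub> w = \<zero>\<^bsub>T\<^esub>"
  using pure_add_left[of "\<zero>\<^bsub>V\<^esub>" "\<zero>\<^bsub>V\<^esub>" w] T.add.l_cancel_one' by fastforce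

lemma minus_pure:
  assumes "v \<in> carrier V" "w \<in> carrier W"
  shows "\<ominus>\<^bsub>T\<^esub> t v w = t (\<ominus>\<^bsub>V\<^esub> v) w"
  using pure_add_left[of "\<ominus>\<^bsub>V\<^esub> v" v w] assms
  by (intro T.minus_equality) (auto simp: V.M.l_neg pure_zero_left)

lemma coset_minus:
  assumes "a \<in> carrier F"
  shows "coset (- a) = \<ominus>\<^bsub>T\<^esub> coset a"
proof -
  have "- a \<in> carrier F" using assms by simp
  then show ?thesis
  using coset_add[of "- a" a] assms
  by (intro T.minus_equality[symmetric]) (auto simp: coset_zero tensor_carrier)
qed

text \<open>
  Subgroup generators occur with both signs, but \<open>-(v \<otimes> w) = (-v) \<otimes> w\<close> is again a pure tensor.
  Hence every element is a finite sum of pure tensors, and the induction needs no step for negation.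
\<close>

lemma tensor_subspace_induct [consumes 2, case_names zero pure add]:
  assumes u: "u \<in> tensor_subspace K V W S" and S: "S \<subseteq> carrier W"
    and zero: "Q \<zero>\<^bsub>T\<^esub>"
    and pure: "\<And>v w. v \<in> carrier V \<Longrightarrow> w \<in> S \<Longrightarrow> Q (t v w)"
    and add: "\<And>a b. a \<in> tensor_subspace K V W S \<Longrightarrow> b \<in> tensor_subspace K V W S \<Longrightarrow>
      a \<in> carrier T \<Longrightarrow> b \<in> carrier T \<Longrightarrow> Q a \<Longrightarrow> Q b \<Longrightarrow> Q (a \<oplus>\<^bsub>T\<^esub> b)"
  shows "Q u"
proof -
  have gens: "{t v w |v w. v \<in> carrier V \<and> w \<in> S} \<subseteq> carrier T"
    using S by auto
  show ?thesis
    using u unfolding tensor_subspace_def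
  proof (induction u)
    case one
    then show ?case using zero by simp
  next
    case (incl h)
    then show ?case using pure by auto
  next
    case (inv h)
    then obtain v w where h: "h = t v w" "v \<in> carrier V" "w \<in> S" by auto
    then have "inv\<^bsub>add_monoid T\<^esub> h = t (\<ominus>\<^bsub>V\<^esub> v) w"
      using S minus_pure[of v w] by (auto simp: a_inv_def)
    with h pure show ?case by simp
  next
    case (eng a b)
    then show ?case
      using add[of a b] T.add.generate_in_carrier[OF gens]
      unfolding tensor_subspace_def by simp
  qed
qed

lemma tensor_subspace_subgroup:
  assumes "S \<subseteq> carrier W"
  shows "subgroup (tensor_subspace K V W S) (add_monoid T)"
  unfolding tensor_subspace_def
  by (rule T.add.generate_is_subgroup) (use assms in auto)

lemma pure_in_tensor_subspace:
  "v \<in> carrier V \<Longrightarrow> w \<in> S \<Longrightarrow> t v w \<in> tensor_subspace K V W S"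
  unfolding tensor_subspace_def by (rule generate.incl) auto

text \<open>
  Because of this, one induction principle serves both the whole tensor product and its graded parts.
\<close>

lemma tensor_subspace_carrier: "tensor_subspace K V W (carrier W) = carrier T"
proof
  let ?S = "tensor_subspace K V W (carrier W)"
  interpret S: subgroup ?S "add_monoid T"
    by (rule tensor_subspace_subgroup) simp
  show "?S \<subseteq> carrier T" using S.subset by simp
  show "carrier T \<subseteq> ?S"
  proof
    fix u assume "u \<in> carrier T"
    then obtain c where c: "c \<in> carrier F" and u: "u = coset c"
      unfolding tensor_carrier by auto
    have "coset c \<in> ?S"
      using c[simplified]
    proof (induction c rule: free_Abelian_group_induct[consumes 1, case_names zero diff single])
      case zero
      then show ?case using S.one_closed by (simp add: coset_zero)
    next
      case (diff x y)
      then have "coset (x - y) = coset x \<oplus>\<^bsub>T\<^esub> \<ominus>\<^bsub>T\<^esub> coset y"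
        using coset_add[of x "- y"] by (simp add: coset_minus)
      moreover have "\<ominus>\<^bsub>T\<^esub> coset y \<in> ?S"
        using S.m_inv_closed[of "coset y"] diff by (simp add: a_inv_def)
      ultimately show ?case
        using diff S.m_closed by simp
    next
      case (single a)
      then show ?case
        using pure_in_tensor_subspace[of "fst a" "snd a"] by (auto simp: pure_tensor_coset)
    qed
    with u show "u \<in> ?S" by simp
  qed
qed

lemma tensor_induct [consumes 1, case_names zero pure add]:
  assumes "u \<in> carrier T"
    and "Q \<zero>\<^bsub>T\<^esub>"
    and "\<And>v w. v \<in> carrier V \<Longrightarrow> w \<in> carrier W \<Longrightarrow> Q (t v w)"
    and "\<And>a b. a \<in> carrier T \<Longrightarrow> b \<in> carrier T \<Longrightarrow> Q a \<Longrightarrow> Q b \<Longrightarrow> Q (a \<oplus>\<^bsub>T\<^esub> b)"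
  shows "Q u"
  using tensor_subspace_induct[of u "carrier W" Q] assms
  by (auto simp: tensor_subspace_carrier)

lemma tensor_smult_closed:
  assumes k: "k \<in> carrier K" and u: "u \<in> carrier T"
  shows "k \<odot>\<^bsub>T\<^esub> u \<in> carrier T"
  using u unfolding tensor_carrier by (auto simp: smult_coset[OF k] simp del: carrier_free_Abelian_group_iff intro!: imageI scale_carrier[OF k])

lemma tensor_smult_add:
  assumes k: "k \<in> carrier K" and u: "u \<in> carrier T" and u': "u' \<in> carrier T"
  shows "k \<odot>\<^bsub>T\<^esub> (u \<oplus>\<^bsub>T\<^esub> u') = k \<odot>\<^bsub>T\<^esub> u \<oplus>\<^bsub>T\<^esub> k \<odot>\<^bsub>T\<^esub> u'"
proof -
  obtain a b where "u = coset a" "u' = coset b" and ab: "a \<in> carrier F" "b \<in> carrier F"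
    using u u' unfolding tensor_carrier by auto
  moreover have "a + b \<in> carrier F"
    using F.m_closed[OF ab] by simp
  ultimately show ?thesis
    using scale_carrier[OF k] by (simp add: smult_coset[OF k] coset_add frag_extend_add
      del: carrier_free_Abelian_group_iff)
qed

lemma tensor_smult_zero: "k \<in> carrier K \<Longrightarrow> k \<odot>\<^bsub>T\<^esub> \<zero>\<^bsub>T\<^esub> = \<zero>\<^bsub>T\<^esub>"
  using smult_coset[of k 0] by (simp add: coset_zero)

lemma tensor_module: "module K T"
proof (rule moduleI)
  show "cring K" ..
  show "abelian_group T" ..
  fix k l u
  assume k: "k \<in> carrier K" and l: "l \<in> carrier K" and u: "u \<in> carrier T"
  note T_simps = tensor_smult_closed tensor_smult_add tensor_smult_zero smult_pure
  show "(k \<oplus>\<^bsub>K\<^esub> l) \<odot>\<^bsub>T\<^esub> u = k \<odot>\<^bsub>T\<^esub> u \<oplus>\<^bsub>T\<^esub> l \<odot>\<^bsub>T\<^esub> u"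
    using u
  proof (induction u rule: tensor_induct)
    case (add a b)
    with k l show ?case
      by (simp add: T_simps T.a_ac)
  qed (use k l in \<open>simp_all add: T_simps V.smult_l_distr pure_add_left\<close>)
  show "(k \<otimes>\<^bsub>K\<^esub> l) \<odot>\<^bsub>T\<^esub> u = k \<odot>\<^bsub>T\<^esub> (l \<odot>\<^bsub>T\<^esub> u)"
    using u
  proof (induction u rule: tensor_induct)
    case (add a b)
    with k l show ?case
      by (simp add: T_simps)
  qed (use k l in \<open>simp_all add: T_simps V.smult_assoc1\<close>)
next
  fix u assume "u \<in> carrier T"
  then show "\<one>\<^bsub>K\<^esub> \<odot>\<^bsub>T\<^esub> u = u"
    by (induction u rule: tensor_induct) (simp_all add: tensor_smult_add tensor_smult_zero smult_pure)
qed (simp_all add: tensor_smult_closed tensor_smult_add)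

sublocale T: module K T
  by (rule tensor_module)

lemma pure_bilinear: "bilinear_map K V W T t"
  by (rule bilinear_mapI)
    (simp_all add: pure_add_left pure_add_right smult_pure pure_balanced[symmetric])

lemma tensor_subspace_submodule:
  assumes S: "submodule S K W"
  shows "submodule (tensor_subspace K V W S) K T"
proof -
  have sub: "S \<subseteq> carrier W"
    using W.submoduleE(1)[OF S] .
  interpret X: subgroup "tensor_subspace K V W S" "add_monoid T"
    by (rule tensor_subspace_subgroup[OF sub])
  have "k \<odot>\<^bsub>T\<^esub> u \<in> tensor_subspace K V W S"
    if k: "k \<in> carrier K" and "u \<in> tensor_subspace K V W S" for k u
    using that(2) sub
  proof (induction u rule: tensor_subspace_induct)
    case zero
    then show ?case using X.one_closed k by simp
  next
    case (pure v w)
    then show ?case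
      using k pure_in_tensor_subspace[of "k \<odot>\<^bsub>V\<^esub> v" w S] subsetD[OF sub, of w] by (simp add: smult_pure)
  next
    case (add a b)
    then show ?case using X.m_closed k by (simp add: T.smult_r_distr)
  qed
  then show ?thesis
    by (intro submodule.intro X.subgroup_axioms) (simp add: submodule_axioms_def)
qed

text \<open>
  The universal property: \<open>f\<close> extends to the free abelian group, bilinearity says that the
  extension kills the defining relations, so it descends to the quotient.  The result is additive by
  construction, and \<open>K\<close>-linear because this can be tested on pure tensors.
\<close>

lemma tensor_universal:
  assumes M: "module K M" and f: "bilinear_map K V W M f"
  shows "\<exists>g. linear_map K T M g \<and> (\<forall>v\<in>carrier V. \<forall>w\<in>carrier W. g (t v w) = f v w)"
proof -
  interpret M: module K M by fact
  note f_simps = bilinear_map_simps[OF f]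
  obtain h where hom: "h \<in> hom F (add_monoid M)"
    and h: "\<And>p. p \<in> carrier V \<times> carrier W \<Longrightarrow> h (frag_of p) = case_prod f p"
    by (rule comm_group.free_Abelian_group_universal[OF M.a_comm_group, of "case_prod f" "carrier V \<times> carrier W"])
      (auto simp: f_simps)
  interpret h: group_hom F "add_monoid M" h
    using hom by unfold_locales
  have diff: "h (a - b) = h a \<oplus>\<^bsub>M\<^esub> \<ominus>\<^bsub>M\<^esub> h b" if "a \<in> carrier F" "b \<in> carrier F" for a b
    using h.hom_mult[of a "- b"] h.hom_inv[of b] that by (simp add: a_inv_def)
  have cancel: "a \<oplus>\<^bsub>M\<^esub> b \<oplus>\<^bsub>M\<^esub> \<ominus>\<^bsub>M\<^esub> a \<oplus>\<^bsub>M\<^esub> \<ominus>\<^bsub>M\<^esub> b = \<zero>\<^bsub>M\<^esub>" if "a \<in> carrier M" "b \<in> carrier M" for a b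
    using that by (simp add: M.a_comm[of a b] M.a_assoc M.r_neg)
  have "tensor_relations K V W \<subseteq> kernel F (add_monoid M) h"
  proof
    fix c assume c: "c \<in> tensor_relations K V W"
    then have "h c = \<one>\<^bsub>add_monoid M\<^esub>"
      by (cases rule: tensor_relationsE)
        (simp_all add: diff diff_free frag_of_free h f_simps cancel M.r_neg
        del: carrier_free_Abelian_group_iff)
    with c show "c \<in> kernel F (add_monoid M) h"
      using subsetD[OF tensor_relations_carrier] unfolding kernel_def by blast
  qed
  then have "N \<subseteq> kernel F (add_monoid M) h"
    unfolding tensor_null_def by (rule F.generate_subgroup_incl) (rule h.subgroup_kernel)
  then obtain g where g: "g \<in> hom (F Mod N) (add_monoid M)"
    and gc: "\<And>x. x \<in> carrier F \<Longrightarrow> g (N #>\<^bsub>F\<^esub> x) = h x"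
    using h.FactGroup_universal_kernel[OF null_normal] by metis
  have g_pure: "g (t v w) = f v w" if "v \<in> carrier V" "w \<in> carrier W" for v w
    using gc[OF frag_of_free[OF that]] h that by (simp add: pure_tensor_def)
  have g_closed: "g u \<in> carrier M" if "u \<in> carrier T" for u
    using g that unfolding hom_def tensor_quotient by auto
  have g_add: "g (u \<oplus>\<^bsub>T\<^esub> u') = g u \<oplus>\<^bsub>M\<^esub> g u'" if "u \<in> carrier T" "u' \<in> carrier T" for u u'
    using g that unfolding hom_def tensor_quotient by auto
  have g_zero: "g \<zero>\<^bsub>T\<^esub> = \<zero>\<^bsub>M\<^esub>"
    using g_add[of "\<zero>\<^bsub>T\<^esub>" "\<zero>\<^bsub>T\<^esub>"] g_closed[of "\<zero>\<^bsub>T\<^esub>"] M.add.l_cancel_one' by fastforce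
  have g_smult: "g (k \<odot>\<^bsub>T\<^esub> u) = k \<odot>\<^bsub>M\<^esub> g u" if k: "k \<in> carrier K" and "u \<in> carrier T" for k u
    using that(2)
  proof (induction u rule: tensor_induct)
    case (add a b)
    then show ?case by (simp add: k T.smult_r_distr g_add g_closed M.smult_r_distr)
  qed (use k in \<open>simp_all add: g_zero smult_pure g_pure f_simps\<close>)
  show ?thesis
    by (intro exI[of _ g]) (auto simp: linear_map_def g_closed g_add g_smult g_pure)
qed

end

lemma (in module_pair) tensor_linear_map:
  assumes M: "module K M" and f: "linear_map K W M f"
  shows "\<exists>g. linear_map K T (tensor_product K V M) g \<and>
    (\<forall>v\<in>carrier V. \<forall>w\<in>carrier W. g (t v w) = pure_tensor K V M v (f w))"
proof -
  interpret M: module K M by fact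
  interpret VM: module_pair K V M ..
  have "bilinear_map K V W VM.T (\<lambda>v w. VM.t v (f w))"
    by (rule bilinear_mapI)
      (simp_all add: linear_map_closed[OF f] linear_map_add[OF f] linear_map_smult[OF f]
        bilinear_map_simps[OF VM.pure_bilinear])
  then show ?thesis
    by (rule tensor_universal[OF VM.tensor_module])
qed

text \<open>
  The universal property is applied once per argument.  For fixed \<open>v, w\<close> it extends
  \<open>(v', w') \<mapsto> m v v' \<otimes> f w w'\<close> to a linear map \<open>L v w\<close>.  For fixed \<open>u\<close> the value \<open>L v w u\<close> is bilinear
  in \<open>(v, w)\<close>, which is checked by induction on \<open>u\<close>, and so extends to a linear map \<open>R u\<close>.
  The operation sought is \<open>(x, u) \<mapsto> R u x\<close>.
\<close>

lemma (in module_pair) tensor_bilinear_map: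
  assumes m: "bilinear_map K V V V m" and f: "bilinear_map K W W W f"
  shows "\<exists>b. bilinear_map K T T T b \<and>
    (\<forall>v\<in>carrier V. \<forall>w\<in>carrier W. \<forall>v'\<in>carrier V. \<forall>w'\<in>carrier W.
      b (t v w) (t v' w') = t (m v v') (f w w'))"
proof -
  note simps = bilinear_map_simps[OF m] bilinear_map_simps[OF f] bilinear_map_simps[OF pure_bilinear]
  have "\<exists>g. linear_map K T T g \<and> (\<forall>v'\<in>carrier V. \<forall>w'\<in>carrier W. g (t v' w') = t (m v v') (f w w'))"
    if vw: "v \<in> carrier V" "w \<in> carrier W" for v w
  proof -
    have "bilinear_map K V W T (\<lambda>v' w'. t (m v v') (f w w'))"
      by (rule bilinear_mapI) (simp_all add: simps vw)
    then show ?thesis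
      by (rule tensor_universal[OF tensor_module])
  qed
  then obtain L where L: "\<And>v w. v \<in> carrier V \<Longrightarrow> w \<in> carrier W \<Longrightarrow> linear_map K T T (L v w)"
    and L_pure: "\<And>v w v' w'. v \<in> carrier V \<Longrightarrow> w \<in> carrier W \<Longrightarrow> v' \<in> carrier V \<Longrightarrow> w' \<in> carrier W \<Longrightarrow>
      L v w (t v' w') = t (m v v') (f w w')"
    by metis
  note L_simps = linear_map_closed[OF L] linear_map_add[OF L] linear_map_smult[OF L] L_pure
    linear_map_zero[OF T.abelian_group_axioms T.abelian_group_axioms L]
  have L_bilinear: "bilinear_map K V W T (\<lambda>v w. L v w u)" if u: "u \<in> carrier T" for u
  proof (rule bilinear_mapI)
    show "L v (w \<oplus>\<^bsub>W\<^esub> w') u = L v w u \<oplus>\<^bsub>T\<^esub> L v w' u"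
      if "v \<in> carrier V" "w \<in> carrier W" "w' \<in> carrier W" for v w w'
      using u
    proof (induction u rule: tensor_induct)
      case (add a b)
      with that show ?case by (simp add: L_simps T.a_ac)
    qed (use that in \<open>simp_all add: L_simps simps\<close>)
    show "L (v \<oplus>\<^bsub>V\<^esub> v') w u = L v w u \<oplus>\<^bsub>T\<^esub> L v' w u"
      if "v \<in> carrier V" "v' \<in> carrier V" "w \<in> carrier W" for v v' w
      using u
    proof (induction u rule: tensor_induct)
      case (add a b)
      with that show ?case by (simp add: L_simps T.a_ac)
    qed (use that in \<open>simp_all add: L_simps simps\<close>)
    show "L v (k \<odot>\<^bsub>W\<^esub> w) u = k \<odot>\<^bsub>T\<^esub> L v w u"
      if "k \<in> carrier K" "v \<in> carrier V" "w \<in> carrier W" for k v w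
      using u
    proof (induction u rule: tensor_induct)
      case (add a b)
      with that show ?case by (simp add: L_simps T.smult_r_distr)
    qed (use that in \<open>simp_all add: L_simps simps\<close>)
    show "L (k \<odot>\<^bsub>V\<^esub> v) w u = k \<odot>\<^bsub>T\<^esub> L v w u"
      if "k \<in> carrier K" "v \<in> carrier V" "w \<in> carrier W" for k v w
      using u
    proof (induction u rule: tensor_induct)
      case (add a b)
      with that show ?case by (simp add: L_simps T.smult_r_distr)
    qed (use that in \<open>simp_all add: L_simps simps\<close>)
  qed (simp add: L_simps u)
  have "\<exists>g. linear_map K T T g \<and> (\<forall>v\<in>carrier V. \<forall>w\<in>carrier W. g (t v w) = L v w u)"
    if u: "u \<in> carrier T" for u
    by (rule tensor_universal[OF tensor_module L_bilinear[OF u]])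
  then obtain R where R: "\<And>u. u \<in> carrier T \<Longrightarrow> linear_map K T T (R u)"
    and R_pure: "\<And>u v w. u \<in> carrier T \<Longrightarrow> v \<in> carrier V \<Longrightarrow> w \<in> carrier W \<Longrightarrow> R u (t v w) = L v w u"
    by metis
  note R_simps = linear_map_closed[OF R] linear_map_add[OF R] linear_map_smult[OF R] R_pure
    linear_map_zero[OF T.abelian_group_axioms T.abelian_group_axioms R]
  have "bilinear_map K T T T (\<lambda>x u. R u x)"
  proof (rule bilinear_mapI)
    fix x u u' k
    assume x: "x \<in> carrier T" and u: "u \<in> carrier T"
    show "R u x \<in> carrier T"
      using x u by (simp add: R_simps)
    show "R (u \<oplus>\<^bsub>T\<^esub> u') x = R u x \<oplus>\<^bsub>T\<^esub> R u' x" if u': "u' \<in> carrier T"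
      using x
    proof (induction x rule: tensor_induct)
      case (add a b)
      with u u' show ?case by (simp add: R_simps T.a_ac)
    qed (use u u' in \<open>simp_all add: R_simps L_simps\<close>)
    show "R (k \<odot>\<^bsub>T\<^esub> u) x = k \<odot>\<^bsub>T\<^esub> R u x" if k: "k \<in> carrier K"
      using x
    proof (induction x rule: tensor_induct)
      case (add a b)
      with u k show ?case by (simp add: R_simps T.smult_r_distr)
    qed (use u k in \<open>simp_all add: R_simps L_simps\<close>)
  qed (simp_all add: R_simps)
  then show ?thesis
    by (intro exI[of _ "\<lambda>x u. R u x"]) (simp add: R_simps L_simps)
qed

section \<open>Gradings and their projections\<close>

lemma (in abelian_monoid) finsum_mono_neutral:
  assumes "finite B" "A \<subseteq> B" "f \<in> B \<rightarrow> carrier G" "\<And>b. b \<in> B - A \<Longrightarrow> f b = \<zero>"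
  shows "(\<Oplus>b\<in>A. f b) = (\<Oplus>b\<in>B. f b)"
  using assms by (intro add.finprod_mono_neutral_cong_left) auto

text \<open>
  A grading described by the projections onto its components.  In contrast to the existence of unique
  decompositions, this description consists of linear maps and equations between them, and can be
  transported along the functor \<open>V \<otimes> -\<close>.
\<close>

definition grading_projections ::
  "('k, 'a) ring_scheme \<Rightarrow> ('g, 'b) monoid_scheme \<Rightarrow> ('k, 'v, 'c) module_scheme \<Rightarrow>
    ('g \<Rightarrow> 'v set) \<Rightarrow> ('g \<Rightarrow> 'v \<Rightarrow> 'v) \<Rightarrow> bool"
  where "grading_projections K G V gr p \<longleftrightarrow>
    (\<forall>g\<in>carrier G. linear_map K V V (p g) \<and> p g \<in> carrier V \<rightarrow> gr g \<and> (\<forall>x\<in>gr g. p g x = x) \<and>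
      (\<forall>g'\<in>carrier G. g' \<noteq> g \<longrightarrow> (\<forall>x\<in>gr g'. p g x = \<zero>\<^bsub>V\<^esub>))) \<and>
    (\<forall>x\<in>carrier V. \<exists>A. finite A \<and> A \<subseteq> carrier G \<and> (\<forall>g\<in>carrier G - A. p g x = \<zero>\<^bsub>V\<^esub>) \<and>
      x = (\<Oplus>\<^bsub>V\<^esub>g\<in>A. p g x))"

lemma (in graded_vector_space) gr_facts:
  assumes "g \<in> carrier G"
  shows gr_carrier: "x \<in> gr g \<Longrightarrow> x \<in> carrier V"
    and gr_zero: "\<zero>\<^bsub>V\<^esub> \<in> gr g"
    and gr_add: "x \<in> gr g \<Longrightarrow> y \<in> gr g \<Longrightarrow> x \<oplus>\<^bsub>V\<^esub> y \<in> gr g"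
    and gr_smult: "k \<in> carrier K \<Longrightarrow> x \<in> gr g \<Longrightarrow> k \<odot>\<^bsub>V\<^esub> x \<in> gr g"
proof -
  interpret S: submodule "gr g" K V
    by (rule gr_subspace[OF assms])
  show "x \<in> gr g \<Longrightarrow> x \<in> carrier V" "\<zero>\<^bsub>V\<^esub> \<in> gr g"
    "x \<in> gr g \<Longrightarrow> y \<in> gr g \<Longrightarrow> x \<oplus>\<^bsub>V\<^esub> y \<in> gr g"
    "k \<in> carrier K \<Longrightarrow> x \<in> gr g \<Longrightarrow> k \<odot>\<^bsub>V\<^esub> x \<in> gr g"
    using S.subset S.one_closed S.m_closed by auto
qed

text \<open>
  The projections pick out the entries of the unique decomposition.  Each of their properties comes
  from exhibiting a decomposition and appealing to uniqueness.
\<close>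

lemma (in graded_vector_space) grading_projections_exist:
  obtains p where "grading_projections K G V gr p"
proof -
  define supp where "supp f = {g \<in> carrier G. f g \<noteq> \<zero>\<^bsub>V\<^esub>}" for f
  define D where "D x f \<longleftrightarrow> f \<in> (\<Pi>\<^sub>E g\<in>carrier G. gr g) \<and> finite (supp f) \<and>
      x = (\<Oplus>\<^bsub>V\<^esub>g\<in>supp f. f g)" for x f
  define p where "p g x = (THE f. D x f) g" for g x
  have D_carrier: "f g \<in> carrier V" if "D x f" "g \<in> carrier G" for x f g
    using that gr_carrier unfolding D_def by auto
  have ex: "\<exists>!f. D x f" if "x \<in> carrier V" for x
    using direct_sum[OF that] unfolding D_def supp_def .
  have p_eq: "p g x = f g" if "x \<in> carrier V" "D x f" for x f g
    using the1_equality[of "D x", OF ex[OF that(1)] that(2)] by (simp add: p_def)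
  have p_D: "D x (\<lambda>g. p g x)" if "x \<in> carrier V" for x
    unfolding p_def using theI'[OF ex[OF that]] by simp
  have D_sum: "x = (\<Oplus>\<^bsub>V\<^esub>g\<in>A. f g)" if "D x f" "finite A" "A \<subseteq> carrier G" "supp f \<subseteq> A" for x f A
  proof -
    have "(\<Oplus>\<^bsub>V\<^esub>g\<in>supp f. f g) = (\<Oplus>\<^bsub>V\<^esub>g\<in>A. f g)"
      using that D_carrier[OF that(1)] by (intro V.finsum_mono_neutral) (auto simp: supp_def)
    with that show ?thesis unfolding D_def by simp
  qed
  \<comment> \<open>A decomposition may be indexed by any finite set of degrees containing the support.\<close>
  have DI: "D x (restrict f (carrier G))" if "\<And>g. g \<in> carrier G \<Longrightarrow> f g \<in> gr g"
    and A: "finite A" "A \<subseteq> carrier G" "\<And>g. g \<in> carrier G - A \<Longrightarrow> f g = \<zero>\<^bsub>V\<^esub>"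
    and x: "x = (\<Oplus>\<^bsub>V\<^esub>g\<in>A. f g)" for x f A
  proof -
    let ?f = "restrict f (carrier G)"
    have sub: "supp ?f \<subseteq> A" using A by (auto simp: supp_def)
    have f: "f g \<in> carrier V" if "g \<in> A" for g
      using gr_carrier[of g "f g"] \<open>\<And>g. g \<in> carrier G \<Longrightarrow> f g \<in> gr g\<close> A(2) that by auto
    have eq: "?f g = f g" if "g \<in> A" for g
      using A(2) that by auto
    have "(\<Oplus>\<^bsub>V\<^esub>g\<in>supp ?f. ?f g) = (\<Oplus>\<^bsub>V\<^esub>g\<in>A. ?f g)"
      using A sub f eq by (intro V.finsum_mono_neutral) (auto simp: supp_def)
    also have "\<dots> = (\<Oplus>\<^bsub>V\<^esub>g\<in>A. f g)"
      using f eq by (intro V.finsum_cong') auto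
    finally have "x = (\<Oplus>\<^bsub>V\<^esub>g\<in>supp ?f. ?f g)"
      by (simp only: x)
    moreover have "?f \<in> (\<Pi>\<^sub>E g\<in>carrier G. gr g)"
      using that(1) by auto
    ultimately show ?thesis
      unfolding D_def using finite_subset[OF sub A(1)] by blast
  qed
  have supp_sub: "supp f \<subseteq> carrier G" for f by (auto simp: supp_def)
  have p_gr: "p g x \<in> gr g" if "x \<in> carrier V" "g \<in> carrier G" for g x
    using p_D[OF that(1)] that(2) unfolding D_def by auto
  have p_carrier: "p g x \<in> carrier V" if "x \<in> carrier V" "g \<in> carrier G" for g x
    using p_gr gr_carrier that by auto
  have p_homogeneous: "p g' x = (if g' = g then x else \<zero>\<^bsub>V\<^esub>)"
    if g: "g \<in> carrier G" "g' \<in> carrier G" and x: "x \<in> gr g" for g g' x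
  proof -
    have "x = (\<Oplus>\<^bsub>V\<^esub>h\<in>{g}. if h = g then x else \<zero>\<^bsub>V\<^esub>)"
      using gr_carrier[OF g(1) x] by simp
    then have "D x (restrict (\<lambda>h. if h = g then x else \<zero>\<^bsub>V\<^esub>) (carrier G))"
      using g(1) x gr_zero by (intro DI[of _ "{g}"]) auto
    from p_eq[OF gr_carrier[OF g(1) x] this] g show ?thesis by simp
  qed
  have p_add: "p g (x \<oplus>\<^bsub>V\<^esub> y) = p g x \<oplus>\<^bsub>V\<^esub> p g y"
    if g: "g \<in> carrier G" and x: "x \<in> carrier V" and y: "y \<in> carrier V" for g x y
  proof -
    let ?A = "supp (\<lambda>g. p g x) \<union> supp (\<lambda>g. p g y)"
    have A: "finite ?A" "?A \<subseteq> carrier G"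
      using p_D[OF x] p_D[OF y] supp_sub unfolding D_def by auto
    have "x \<oplus>\<^bsub>V\<^esub> y = (\<Oplus>\<^bsub>V\<^esub>g\<in>?A. p g x) \<oplus>\<^bsub>V\<^esub> (\<Oplus>\<^bsub>V\<^esub>g\<in>?A. p g y)"
      using D_sum[OF p_D[OF x] A] D_sum[OF p_D[OF y] A] by simp
    also have "\<dots> = (\<Oplus>\<^bsub>V\<^esub>g\<in>?A. p g x \<oplus>\<^bsub>V\<^esub> p g y)"
      using A(2) p_carrier x y by (intro V.finsum_addf[symmetric]) (auto simp: subset_iff)
    finally have "D (x \<oplus>\<^bsub>V\<^esub> y) (restrict (\<lambda>g. p g x \<oplus>\<^bsub>V\<^esub> p g y) (carrier G))"
      using p_gr x y gr_add by (intro DI[OF _ A]) (auto simp: supp_def)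
    from p_eq[OF _ this, of g] g x y show ?thesis by simp
  qed
  have p_smult: "p g (k \<odot>\<^bsub>V\<^esub> x) = k \<odot>\<^bsub>V\<^esub> p g x"
    if g: "g \<in> carrier G" and k: "k \<in> carrier K" and x: "x \<in> carrier V" for g k x
  proof -
    let ?A = "supp (\<lambda>g. p g x)"
    have A: "finite ?A" "?A \<subseteq> carrier G"
      using p_D[OF x] supp_sub unfolding D_def by auto
    have "k \<odot>\<^bsub>V\<^esub> x = k \<odot>\<^bsub>V\<^esub> (\<Oplus>\<^bsub>V\<^esub>g\<in>?A. p g x)"
      using D_sum[OF p_D[OF x] A] by simp
    also have "\<dots> = (\<Oplus>\<^bsub>V\<^esub>g\<in>?A. k \<odot>\<^bsub>V\<^esub> p g x)"
      using A p_carrier x k by (intro V.finsum_smult_ldistr) (auto simp: subset_iff)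
    finally have "D (k \<odot>\<^bsub>V\<^esub> x) (restrict (\<lambda>g. k \<odot>\<^bsub>V\<^esub> p g x) (carrier G))"
      using p_gr x k gr_smult by (intro DI[OF _ A]) (auto simp: supp_def)
    from p_eq[OF _ this, of g] g x k show ?thesis by simp
  qed
  have "\<exists>A. finite A \<and> A \<subseteq> carrier G \<and> (\<forall>g\<in>carrier G - A. p g x = \<zero>\<^bsub>V\<^esub>) \<and> x = (\<Oplus>\<^bsub>V\<^esub>g\<in>A. p g x)"
    if "x \<in> carrier V" for x
    using p_D[OF that] unfolding D_def
    by (intro exI[of _ "supp (\<lambda>g. p g x)"]) (auto simp: supp_def)
  then have "grading_projections K G V gr p"
    unfolding grading_projections_def linear_map_def
    using p_gr p_carrier p_homogeneous p_add p_smult by auto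
  then show thesis by (rule that)
qed

text \<open>
  Conversely, applying the projection of degree \<open>g\<close> to any decomposition isolates its entry of degree
  \<open>g\<close>, which makes the decomposition unique.
\<close>

lemma graded_vector_spaceI:
  assumes "field K" and "comm_group G" and "module K V"
    and sub: "\<And>g. g \<in> carrier G \<Longrightarrow> submodule (gr g) K V"
    and p: "grading_projections K G V gr p"
  shows "graded_vector_space K G V gr"
proof -
  interpret V: module K V by fact
  have gr: "x \<in> carrier V" if "g \<in> carrier G" "x \<in> gr g" for g x
    using V.submoduleE(1)[OF sub[OF that(1)]] that(2) by auto
  have lin: "linear_map K V V (p g)" and p_gr: "\<And>x. x \<in> carrier V \<Longrightarrow> p g x \<in> gr g"
    and p_id: "\<And>x. x \<in> gr g \<Longrightarrow> p g x = x"
    and p_other: "\<And>g' x. g' \<in> carrier G \<Longrightarrow> g' \<noteq> g \<Longrightarrow> x \<in> gr g' \<Longrightarrow> p g x = \<zero>\<^bsub>V\<^esub>"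
    if "g \<in> carrier G" for g
    using p that unfolding grading_projections_def by auto
  have p_carrier: "p g x \<in> carrier V" if "g \<in> carrier G" "x \<in> carrier V" for g x
    using gr p_gr that by blast
  show ?thesis
  proof (intro graded_vector_space.intro graded_vector_space_axioms.intro)
    fix x assume x: "x \<in> carrier V"
    obtain A where A: "finite A" "A \<subseteq> carrier G" "\<forall>g\<in>carrier G - A. p g x = \<zero>\<^bsub>V\<^esub>"
      and sum: "x = (\<Oplus>\<^bsub>V\<^esub>g\<in>A. p g x)"
      using p x unfolding grading_projections_def by metis
    define f where "f = (\<lambda>g\<in>carrier G. p g x)"
    have supp: "{g \<in> carrier G. f g \<noteq> \<zero>\<^bsub>V\<^esub>} \<subseteq> A"
      using A by (auto simp: f_def)
    have f: "p g x = f g" "f g \<in> carrier V" if "g \<in> A" for g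
      using A(2) p_carrier[of g x] x that by (auto simp: f_def)
    note sum
    also have "(\<Oplus>\<^bsub>V\<^esub>g\<in>A. p g x) = (\<Oplus>\<^bsub>V\<^esub>g\<in>A. f g)"
      using f by (intro V.finsum_cong') auto
    also have "\<dots> = (\<Oplus>\<^bsub>V\<^esub>g\<in>{g \<in> carrier G. f g \<noteq> \<zero>\<^bsub>V\<^esub>}. f g)"
      using A(1,2) supp f by (intro V.finsum_mono_neutral[symmetric]) auto
    finally have f_sum: "x = (\<Oplus>\<^bsub>V\<^esub>g\<in>{g \<in> carrier G. f g \<noteq> \<zero>\<^bsub>V\<^esub>}. f g)" .
    have f_PiE: "f \<in> (\<Pi>\<^sub>E g\<in>carrier G. gr g)"
      using p_gr x by (auto simp: f_def)
    show "\<exists>!f. f \<in> (\<Pi>\<^sub>E g\<in>carrier G. gr g) \<and> finite {g \<in> carrier G. f g \<noteq> \<zero>\<^bsub>V\<^esub>} \<and>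
           x = (\<Oplus>\<^bsub>V\<^esub>g\<in>{g \<in> carrier G. f g \<noteq> \<zero>\<^bsub>V\<^esub>}. f g)"
    proof (rule ex1I[of _ f], intro conjI)
      show "f \<in> (\<Pi>\<^sub>E g\<in>carrier G. gr g)" by (rule f_PiE)
      show "finite {g \<in> carrier G. f g \<noteq> \<zero>\<^bsub>V\<^esub>}"
        using finite_subset[OF supp A(1)] .
      show "x = (\<Oplus>\<^bsub>V\<^esub>g\<in>{g \<in> carrier G. f g \<noteq> \<zero>\<^bsub>V\<^esub>}. f g)" by (rule f_sum)
    next
      fix f' assume f': "f' \<in> (\<Pi>\<^sub>E g\<in>carrier G. gr g) \<and> finite {g \<in> carrier G. f' g \<noteq> \<zero>\<^bsub>V\<^esub>} \<and>
           x = (\<Oplus>\<^bsub>V\<^esub>g\<in>{g \<in> carrier G. f' g \<noteq> \<zero>\<^bsub>V\<^esub>}. f' g)"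
      let ?B = "{g \<in> carrier G. f' g \<noteq> \<zero>\<^bsub>V\<^esub>}"
      have f'_gr: "f' g \<in> gr g" if "g \<in> carrier G" for g
        using f' that by auto
      have "f' g = p g x" if g: "g \<in> carrier G" for g
      proof -
        have "p g x = p g (\<Oplus>\<^bsub>V\<^esub>h\<in>?B. f' h)" using f' by simp
        also have "\<dots> = (\<Oplus>\<^bsub>V\<^esub>h\<in>?B. p g (f' h))"
          using f' f'_gr gr by (intro linear_map_finsum[OF V.abelian_group_axioms V.abelian_group_axioms lin[OF g]]) auto
        also have "\<dots> = (\<Oplus>\<^bsub>V\<^esub>h\<in>?B. if g = h then f' h else \<zero>\<^bsub>V\<^esub>)"
          using g f'_gr gr by (intro V.finsum_cong') (auto simp: p_id p_other)
        also have "\<dots> = f' g"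
        proof (cases "g \<in> ?B")
          case True
          with f' f'_gr gr show ?thesis by (intro V.add.finprod_singleton) auto
        next
          case False
          then have "(\<Oplus>\<^bsub>V\<^esub>h\<in>?B. if g = h then f' h else \<zero>\<^bsub>V\<^esub>) = (\<Oplus>\<^bsub>V\<^esub>h\<in>?B. \<zero>\<^bsub>V\<^esub>)"
            by (intro V.finsum_cong') auto
          with False g show ?thesis by simp
        qed
        finally show ?thesis ..
      qed
      then show "f' = f"
        by (intro PiE_ext[OF conjunct1[OF f'] f_PiE]) (simp add: f_def)
    qed
  qed (use assms in auto)
qed

text \<open>
  If \<open>p g\<close> are the projections of \<open>W\<close>, then \<open>id \<otimes> p g\<close> are projections for the subspaces
  \<open>V \<otimes> W\<^sub>g\<close>: the required equations hold on pure tensors and are additive.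
\<close>

lemma (in module_pair) tensor_grading:
  assumes W_graded: "graded_vector_space K G W gr"
  shows "graded_vector_space K G T (\<lambda>g. tensor_subspace K V W (gr g))"
proof -
  interpret GW: graded_vector_space K G W gr by fact
  let ?X = "\<lambda>g. tensor_subspace K V W (gr g)"
  obtain p where p: "grading_projections K G W gr p"
    by (rule GW.grading_projections_exist)
  have lin: "linear_map K W W (p g)" and p_gr: "\<And>x. x \<in> carrier W \<Longrightarrow> p g x \<in> gr g"
    and p_id: "\<And>x. x \<in> gr g \<Longrightarrow> p g x = x"
    and p_other: "\<And>g' x. g' \<in> carrier G \<Longrightarrow> g' \<noteq> g \<Longrightarrow> x \<in> gr g' \<Longrightarrow> p g x = \<zero>\<^bsub>W\<^esub>"
    if "g \<in> carrier G" for g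
    using p that unfolding grading_projections_def by auto
  have sub: "gr g \<subseteq> carrier W" if "g \<in> carrier G" for g
    using GW.gr_carrier[OF that] by auto
  have "\<exists>q. linear_map K T T q \<and> (\<forall>v\<in>carrier V. \<forall>w\<in>carrier W. q (t v w) = t v (p g w))"
    if "g \<in> carrier G" for g
    by (rule tensor_linear_map[OF W.module_axioms lin[OF that]])
  then obtain q where q: "\<And>g. g \<in> carrier G \<Longrightarrow> linear_map K T T (q g)"
    and q_pure: "\<And>g v w. g \<in> carrier G \<Longrightarrow> v \<in> carrier V \<Longrightarrow> w \<in> carrier W \<Longrightarrow> q g (t v w) = t v (p g w)"
    by metis
  note q_simps = linear_map_closed[OF q] linear_map_add[OF q] q_pure
    linear_map_zero[OF T.abelian_group_axioms T.abelian_group_axioms q]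
  have X_sub: "submodule (?X g) K T" if "g \<in> carrier G" for g
    by (rule tensor_subspace_submodule[OF GW.gr_subspace[OF that]])
  have q_X: "q g u \<in> ?X g" if g: "g \<in> carrier G" and "u \<in> carrier T" for g u
  proof -
    interpret X: submodule "?X g" K T by (rule X_sub[OF g])
    show ?thesis
      using that(2)
    proof (induction u rule: tensor_induct)
      case zero
      with g X.one_closed show ?case by (simp add: q_simps)
    next
      case (pure v w)
      with g p_gr[OF g, of w] show ?case by (simp add: q_simps pure_in_tensor_subspace)
    next
      case (add a b)
      with g X.m_closed[of "q g a" "q g b"] show ?case by (simp add: q_simps)
    qed
  qed
  have q_id: "q g u = u" if g: "g \<in> carrier G" and "u \<in> ?X g" for g u
    using that(2) sub[OF g]
  proof (induction u rule: tensor_subspace_induct)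
    case (pure v w)
    with g sub[OF g] p_id[OF g] show ?case by (auto simp: q_simps)
  qed (use g in \<open>simp_all add: q_simps\<close>)
  have q_other: "q g u = \<zero>\<^bsub>T\<^esub>"
    if g: "g \<in> carrier G" "g' \<in> carrier G" "g' \<noteq> g" and "u \<in> ?X g'" for g g' u
    using that(4) sub[OF g(2)]
  proof (induction u rule: tensor_subspace_induct)
    case (pure v w)
    with g sub[OF g(2)] p_other[OF g] show ?case by (auto simp: q_simps pure_zero_right)
  qed (use g in \<open>simp_all add: q_simps\<close>)
  have q_sum: "\<exists>A. finite A \<and> A \<subseteq> carrier G \<and> (\<forall>g\<in>carrier G - A. q g u = \<zero>\<^bsub>T\<^esub>) \<and>
      u = (\<Oplus>\<^bsub>T\<^esub>g\<in>A. q g u)" if "u \<in> carrier T" for u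
    using that
  proof (induction u rule: tensor_induct)
    case zero
    show ?case by (rule exI[of _ "{}"]) (simp add: q_simps)
  next
    case (pure v w)
    obtain A where A: "finite A" "A \<subseteq> carrier G" "\<forall>g\<in>carrier G - A. p g w = \<zero>\<^bsub>W\<^esub>"
      and sum: "w = (\<Oplus>\<^bsub>W\<^esub>g\<in>A. p g w)"
      using p pure(2) unfolding grading_projections_def by metis
    have A_p: "(\<lambda>g. p g w) \<in> A \<rightarrow> carrier W"
      using A(2) linear_map_closed[OF lin pure(2)] by auto
    have "t v w = t v (\<Oplus>\<^bsub>W\<^esub>g\<in>A. p g w)"
      by (rule arg_cong[OF sum])
    also have "\<dots> = (\<Oplus>\<^bsub>T\<^esub>g\<in>A. t v (p g w))"
      by (rule linear_map_finsum[OF W.abelian_group_axioms T.abelian_group_axioms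
          bilinear_map_linear(1)[OF pure_bilinear pure(1)] A(1) A_p])
    also have "\<dots> = (\<Oplus>\<^bsub>T\<^esub>g\<in>A. q g (t v w))"
      using pure funcset_mem[OF A_p] subsetD[OF A(2)] by (intro T.finsum_cong' refl) (simp_all add: q_simps)
    finally show ?case
      using A pure by (intro exI[of _ A]) (auto simp: q_simps pure_zero_right)
  next
    case (add a b)
    then obtain A B where A: "finite A" "A \<subseteq> carrier G" "\<forall>g\<in>carrier G - A. q g a = \<zero>\<^bsub>T\<^esub>"
        and a: "a = (\<Oplus>\<^bsub>T\<^esub>g\<in>A. q g a)"
      and B: "finite B" "B \<subseteq> carrier G" "\<forall>g\<in>carrier G - B. q g b = \<zero>\<^bsub>T\<^esub>"
        and b: "b = (\<Oplus>\<^bsub>T\<^esub>g\<in>B. q g b)"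
      by metis
    have AB: "(\<lambda>g. q g u) \<in> A \<union> B \<rightarrow> carrier T" if "u \<in> carrier T" for u
      using A(2) B(2) linear_map_closed[OF q that] by blast
    \<comment> \<open>Both sums are brought to a common set of degrees before they are added.\<close>
    have "(\<Oplus>\<^bsub>T\<^esub>g\<in>A. q g a) = (\<Oplus>\<^bsub>T\<^esub>g\<in>A \<union> B. q g a)"
      using A B AB[OF add(1)] by (intro T.finsum_mono_neutral) blast+
    moreover have "(\<Oplus>\<^bsub>T\<^esub>g\<in>B. q g b) = (\<Oplus>\<^bsub>T\<^esub>g\<in>A \<union> B. q g b)"
      using A B AB[OF add(2)] by (intro T.finsum_mono_neutral) blast+
    ultimately have "a \<oplus>\<^bsub>T\<^esub> b = (\<Oplus>\<^bsub>T\<^esub>g\<in>A \<union> B. q g a) \<oplus>\<^bsub>T\<^esub> (\<Oplus>\<^bsub>T\<^esub>g\<in>A \<union> B. q g b)"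
      using a b by simp
    also have "\<dots> = (\<Oplus>\<^bsub>T\<^esub>g\<in>A \<union> B. q g a \<oplus>\<^bsub>T\<^esub> q g b)"
      by (rule T.finsum_addf[OF AB[OF add(1)] AB[OF add(2)], symmetric])
    also have "\<dots> = (\<Oplus>\<^bsub>T\<^esub>g\<in>A \<union> B. q g (a \<oplus>\<^bsub>T\<^esub> b))"
      using subsetD[OF A(2)] subsetD[OF B(2)] add(1,2) AB[of "a \<oplus>\<^bsub>T\<^esub> b"]
      by (intro T.finsum_cong' refl) (auto simp: q_simps)
    finally show ?case
      using A B add(1,2) by (intro exI[of _ "A \<union> B"]) (auto simp: q_simps)
  qed
  have "grading_projections K G T ?X q"
    unfolding grading_projections_def
    by (intro conjI ballI impI funcsetI q q_X q_id q_other q_sum)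
  then show ?thesis
    by (intro graded_vector_spaceI[OF GW.K.field_axioms GW.G.comm_group_axioms tensor_module X_sub])
qed

text \<open>
  For an arbitrary submodule the map \<open>V \<otimes> S \<rightarrow> V \<otimes> W\<close> need not be injective.  When \<open>S\<close> is the image of
  a projection \<open>p\<close> of \<open>W\<close>, the map \<open>id \<otimes> p\<close> is a left inverse.
\<close>

lemma (in module_pair) tensor_of_summand:
  assumes S: "submodule S K W" and p: "linear_map K W W p"
    and p_S: "\<And>w. w \<in> carrier W \<Longrightarrow> p w \<in> S" and p_id: "\<And>w. w \<in> S \<Longrightarrow> p w = w"
  shows "\<exists>\<phi>. linear_map K (tensor_product K V (W\<lparr>carrier := S\<rparr>)) T \<phi> \<and>
    bij_betw \<phi> (carrier (tensor_product K V (W\<lparr>carrier := S\<rparr>))) (tensor_subspace K V W S) \<and>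
    (\<forall>v\<in>carrier V. \<forall>w\<in>S. \<phi> (pure_tensor K V (W\<lparr>carrier := S\<rparr>) v w) = t v w)"
proof -
  let ?S = "W\<lparr>carrier := S\<rparr>"
  note sub = W.submoduleE(1)[OF S]
  interpret S: module K ?S
    by (rule submodule.submodule_is_module[OF S W.module_axioms])
  interpret VS: module_pair K V ?S ..
  interpret X: submodule "tensor_subspace K V W S" K T
    by (rule tensor_subspace_submodule[OF S])
  have inc: "linear_map K ?S W (\<lambda>w. w)"
    using sub unfolding linear_map_def by auto
  obtain \<phi> where \<phi>: "linear_map K VS.T T \<phi>" and "\<forall>v\<in>carrier V. \<forall>w\<in>carrier ?S. \<phi> (VS.t v w) = t v w"
    using VS.tensor_linear_map[OF W.module_axioms inc] by blast
  then have \<phi>_pure: "\<phi> (VS.t v w) = t v w" if "v \<in> carrier V" "w \<in> S" for v w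
    using that by simp
  have p': "linear_map K W ?S p"
    using p p_S unfolding linear_map_def by auto
  obtain \<psi> where \<psi>: "linear_map K T VS.T \<psi>"
    and \<psi>_pure: "\<forall>v\<in>carrier V. \<forall>w\<in>carrier W. \<psi> (t v w) = VS.t v (p w)"
    using tensor_linear_map[OF S.module_axioms p'] by blast
  note \<phi>_simps = linear_map_closed[OF \<phi>] linear_map_add[OF \<phi>] \<phi>_pure
    linear_map_zero[OF VS.T.abelian_group_axioms T.abelian_group_axioms \<phi>]
  note \<psi>_simps = linear_map_add[OF \<psi>] \<psi>_pure
    linear_map_zero[OF T.abelian_group_axioms VS.T.abelian_group_axioms \<psi>]
  have \<psi>\<phi>: "\<psi> (\<phi> u) = u" if "u \<in> carrier VS.T" for u
    using that
  proof (induction u rule: VS.tensor_induct)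
    case (pure v w)
    then show ?case using sub p_id by (auto simp: \<phi>_simps \<psi>_simps)
  qed (simp_all add: \<phi>_simps \<psi>_simps)
  have "\<phi> ` carrier VS.T = tensor_subspace K V W S"
  proof (intro equalityI subsetI)
    fix y assume "y \<in> \<phi> ` carrier VS.T"
    then obtain u where "u \<in> carrier VS.T" "y = \<phi> u" by blast
    then show "y \<in> tensor_subspace K V W S"
    proof (induction u arbitrary: y rule: VS.tensor_induct)
      case zero
      then show ?case using X.one_closed by (simp add: \<phi>_simps)
    next
      case (pure v w)
      then show ?case by (simp add: \<phi>_simps pure_in_tensor_subspace)
    next
      case (add a b)
      then show ?case using X.m_closed[of "\<phi> a" "\<phi> b"] by (simp add: \<phi>_simps)
    qed
  next
    fix u assume "u \<in> tensor_subspace K V W S"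
    then show "u \<in> \<phi> ` carrier VS.T"
      using sub
    proof (induction u rule: tensor_subspace_induct)
      case zero
      show ?case by (rule image_eqI[of _ _ "\<zero>\<^bsub>VS.T\<^esub>"]) (simp_all add: \<phi>_simps)
    next
      case (pure v w)
      then show ?case by (intro image_eqI[of _ _ "VS.t v w"]) (simp_all add: \<phi>_simps)
    next
      case (add a b)
      then obtain a' b' where "a' \<in> carrier VS.T" "b' \<in> carrier VS.T" "a = \<phi> a'" "b = \<phi> b'" by blast
      then show ?case by (intro image_eqI[of _ _ "a' \<oplus>\<^bsub>VS.T\<^esub> b'"]) (simp_all add: \<phi>_simps)
    qed
  qed
  moreover have "inj_on \<phi> (carrier VS.T)"
    by (rule inj_on_inverseI[of _ \<psi>]) (rule \<psi>\<phi>)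
  ultimately show ?thesis
    using \<phi> \<phi>_pure unfolding bij_betw_def by blast
qed

section \<open>Comparing multilinear maps on spanning tensors\<close>

definition trilinear_map ::
  "('k, 'a) ring_scheme \<Rightarrow> ('k, 'u, 'b) module_scheme \<Rightarrow> ('k, 'w, 'c) module_scheme \<Rightarrow>
    ('u \<Rightarrow> 'u \<Rightarrow> 'u \<Rightarrow> 'w) \<Rightarrow> bool"
  where "trilinear_map K U W f \<longleftrightarrow>
    (\<forall>x\<in>carrier U. bilinear_map K U U W (f x)) \<and>
    (\<forall>y\<in>carrier U. \<forall>z\<in>carrier U. linear_map K U W (\<lambda>x. f x y z))"

lemma (in module_pair) linear_map_eq_on_subspace:
  assumes M: "abelian_group M" and f: "linear_map K T M f" and g: "linear_map K T M g"
    and S: "S \<subseteq> carrier W"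
    and pure: "\<And>v w. v \<in> carrier V \<Longrightarrow> w \<in> S \<Longrightarrow> f (t v w) = g (t v w)"
    and u: "u \<in> tensor_subspace K V W S"
  shows "f u = g u"
  using u S
proof (induction u rule: tensor_subspace_induct)
  case zero
  then show ?case
    by (simp add: linear_map_zero[OF T.abelian_group_axioms M f]
        linear_map_zero[OF T.abelian_group_axioms M g])
next
  case (add a b)
  then show ?case by (simp add: linear_map_add[OF f] linear_map_add[OF g])
qed (simp add: pure)

lemma (in module_pair) tensor_subspace_mem_carrier:
  assumes "S \<subseteq> carrier W" and "u \<in> tensor_subspace K V W S"
  shows "u \<in> carrier T"
  using subgroup.subset[OF tensor_subspace_subgroup[OF assms(1)]] assms(2) by auto

lemma (in module_pair) bilinear_map_eq_on_subspaces:
  assumes M: "abelian_group M" and f: "bilinear_map K T T M f" and g: "bilinear_map K T T M g"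
    and S: "S \<subseteq> carrier W" "S' \<subseteq> carrier W"
    and pure: "\<And>v w v' w'. v \<in> carrier V \<Longrightarrow> w \<in> S \<Longrightarrow> v' \<in> carrier V \<Longrightarrow> w' \<in> S' \<Longrightarrow>
      f (t v w) (t v' w') = g (t v w) (t v' w')"
    and u: "u \<in> tensor_subspace K V W S" "u' \<in> tensor_subspace K V W S'"
  shows "f u u' = g u u'"
proof (rule linear_map_eq_on_subspace[OF M _ _ S(1) _ u(1)])
  fix v w assume vw: "v \<in> carrier V" "w \<in> S"
  then have tvw: "t v w \<in> carrier T" using S by auto
  show "f (t v w) u' = g (t v w) u'"
    by (rule linear_map_eq_on_subspace[OF M bilinear_map_linear(1)[OF f tvw]
          bilinear_map_linear(1)[OF g tvw] S(2) _ u(2)]) (rule pure[OF vw])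
qed (intro bilinear_map_linear(2)[OF f] bilinear_map_linear(2)[OF g]
    tensor_subspace_mem_carrier[OF S(2) u(2)])+

lemma (in module_pair) trilinear_map_eq_on_subspaces:
  assumes M: "abelian_group M" and f: "trilinear_map K T M f" and g: "trilinear_map K T M g"
    and S: "S \<subseteq> carrier W" "S' \<subseteq> carrier W" "S'' \<subseteq> carrier W"
    and pure: "\<And>v w v' w' v'' w''. v \<in> carrier V \<Longrightarrow> w \<in> S \<Longrightarrow> v' \<in> carrier V \<Longrightarrow> w' \<in> S' \<Longrightarrow>
      v'' \<in> carrier V \<Longrightarrow> w'' \<in> S'' \<Longrightarrow>
      f (t v w) (t v' w') (t v'' w'') = g (t v w) (t v' w') (t v'' w'')"
    and u: "u \<in> tensor_subspace K V W S" "u' \<in> tensor_subspace K V W S'" "u'' \<in> tensor_subspace K V W S''"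
  shows "f u u' u'' = g u u' u''"
proof -
  have u_T: "u' \<in> carrier T" "u'' \<in> carrier T"
    using tensor_subspace_mem_carrier S u by auto
  show ?thesis
  proof (rule linear_map_eq_on_subspace[OF M _ _ S(1) _ u(1)])
    show "linear_map K T M (\<lambda>u. f u u' u'')" "linear_map K T M (\<lambda>u. g u u' u'')"
      using f g u_T unfolding trilinear_map_def by auto
    fix v w assume vw: "v \<in> carrier V" "w \<in> S"
    then have "t v w \<in> carrier T" using S by auto
    then have "bilinear_map K T T M (f (t v w))" "bilinear_map K T T M (g (t v w))"
      using f g unfolding trilinear_map_def by auto
    then show "f (t v w) u' u'' = g (t v w) u' u''"
      by (rule bilinear_map_eq_on_subspaces[OF M _ _ S(2,3) _ u(2,3)]) (rule pure[OF vw])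
  qed
qed

lemma (in graded_vector_space) linear_map_eq_on_homogeneous:
  assumes M: "abelian_group M" and f: "linear_map K V M f" and f': "linear_map K V M f'"
    and eq: "\<And>g x. g \<in> carrier G \<Longrightarrow> x \<in> gr g \<Longrightarrow> f x = f' x"
    and x: "x \<in> carrier V"
  shows "f x = f' x"
proof -
  obtain c where c: "c \<in> (\<Pi>\<^sub>E g\<in>carrier G. gr g)" and fin: "finite {g \<in> carrier G. c g \<noteq> \<zero>\<^bsub>V\<^esub>}"
    and sum: "x = (\<Oplus>\<^bsub>V\<^esub>g\<in>{g \<in> carrier G. c g \<noteq> \<zero>\<^bsub>V\<^esub>}. c g)"
    using direct_sum[OF x] by blast
  let ?A = "{g \<in> carrier G. c g \<noteq> \<zero>\<^bsub>V\<^esub>}"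
  have c_gr: "c g \<in> gr g" if "g \<in> ?A" for g
    using c that by auto
  have c_V: "c \<in> ?A \<rightarrow> carrier V"
    using c_gr gr_carrier by blast
  have c_eq: "f (c g) = f' (c g)" if "g \<in> ?A" for g
    using eq[OF _ c_gr[OF that]] that by simp
  interpret M: abelian_group M by fact
  have "f x = (\<Oplus>\<^bsub>M\<^esub>g\<in>?A. f (c g))"
    unfolding sum by (rule linear_map_finsum[OF V.abelian_group_axioms M f fin c_V])
  also have "\<dots> = (\<Oplus>\<^bsub>M\<^esub>g\<in>?A. f' (c g))"
    using c_eq linear_map_closed[OF f'] funcset_mem[OF c_V]
    by (intro M.finsum_cong' refl funcsetI) simp_all
  also have "\<dots> = f' x"
    unfolding sum by (rule linear_map_finsum[OF V.abelian_group_axioms M f' fin c_V, symmetric])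
  finally show ?thesis .
qed

text \<open>
  This is what makes the extended operations unique although they are prescribed only on tensors with
  a homogeneous second factor.
\<close>

lemma (in module_pair) linear_map_eq_on_homogeneous_pure:
  assumes W: "graded_vector_space K G W gr"
    and M: "module K M" and f: "linear_map K T M f" and f': "linear_map K T M f'"
    and eq: "\<And>g v w. g \<in> carrier G \<Longrightarrow> v \<in> carrier V \<Longrightarrow> w \<in> gr g \<Longrightarrow> f (t v w) = f' (t v w)"
    and u: "u \<in> carrier T"
  shows "f u = f' u"
proof -
  interpret GW: graded_vector_space K G W gr by fact
  interpret M: module K M by fact
  show ?thesis
  proof (rule linear_map_eq_on_subspace[OF M.abelian_group_axioms f f' subset_refl])
    show "u \<in> tensor_subspace K V W (carrier W)"
      using u by (simp add: tensor_subspace_carrier)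
    fix v w assume v: "v \<in> carrier V" and w: "w \<in> carrier W"
    have "linear_map K W M (\<lambda>w. h (t v w))" if h: "linear_map K T M h" for h
      using v linear_map_closed[OF h] linear_map_add[OF h] linear_map_smult[OF h]
      by (simp add: linear_map_def bilinear_map_simps[OF pure_bilinear])
    from GW.linear_map_eq_on_homogeneous[OF M.abelian_group_axioms this[OF f] this[OF f'] _ w]
    show "f (t v w) = f' (t v w)"
      using eq v by blast
  qed
qed

section \<open>Tensoring with a commutative associative algebra\<close>

text \<open>
  Each identity equates two expressions that are linear in every argument, so it suffices to compare
  them on pure tensors; the conditions on degrees are tested there as well.  On pure tensors the first
  factors multiply in \<open>V\<close>, where commutativity and associativity bring the coefficients of all terms
  to the same product, and the second factors reproduce the axiom of \<open>W\<close>.  The sign factors \<open>\<epsilon>\<close>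
  involve degrees only, to which \<open>V\<close> contributes nothing.
\<close>

lemma (in module_pair) tensor_bihom_poisson_color_algebra:
  assumes m: "bilinear_map K V V V m"
    and m_comm: "\<And>a b. a \<in> carrier V \<Longrightarrow> b \<in> carrier V \<Longrightarrow> m a b = m b a"
    and m_assoc: "\<And>a b c. a \<in> carrier V \<Longrightarrow> b \<in> carrier V \<Longrightarrow> c \<in> carrier V \<Longrightarrow>
      m (m a b) c = m a (m b c)"
    and W: "bihom_poisson_color_algebra K G W gr \<epsilon> mul br \<alpha> \<beta>"
    and mul': "bilinear_map K T T T mul'" and br': "bilinear_map K T T T br'"
    and \<alpha>': "linear_map K T T \<alpha>'" and \<beta>': "linear_map K T T \<beta>'"
    and mul'_pure: "\<And>a b x y. a \<in> carrier V \<Longrightarrow> b \<in> carrier V \<Longrightarrow> x \<in> carrier W \<Longrightarrow> y \<in> carrier W \<Longrightarrow>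
      mul' (t a x) (t b y) = t (m a b) (mul x y)"
    and br'_pure: "\<And>a b x y. a \<in> carrier V \<Longrightarrow> b \<in> carrier V \<Longrightarrow> x \<in> carrier W \<Longrightarrow> y \<in> carrier W \<Longrightarrow>
      br' (t a x) (t b y) = t (m a b) (br x y)"
    and \<alpha>'_pure: "\<And>a x. a \<in> carrier V \<Longrightarrow> x \<in> carrier W \<Longrightarrow> \<alpha>' (t a x) = t a (\<alpha> x)"
    and \<beta>'_pure: "\<And>a x. a \<in> carrier V \<Longrightarrow> x \<in> carrier W \<Longrightarrow> \<beta>' (t a x) = t a (\<beta> x)"
  shows "bihom_poisson_color_algebra K G T (\<lambda>g. tensor_subspace K V W (gr g)) \<epsilon> mul' br' \<alpha>' \<beta>'"
proof -
  interpret P: bihom_poisson_color_algebra K G W gr \<epsilon> mul br \<alpha> \<beta> by fact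
  let ?X = "\<lambda>g. tensor_subspace K V W (gr g)"
  interpret X: graded_vector_space K G T ?X
    by (rule tensor_grading) (rule P.graded_vector_space_axioms)
  have gr: "gr g \<subseteq> carrier W" if "g \<in> carrier G" for g
    using P.gr_carrier[OF that] by auto
  have grD: "x \<in> carrier W" if "g \<in> carrier G" "x \<in> gr g" for g x
    using P.gr_carrier that by auto
  have \<epsilon>: "\<epsilon> g g' \<in> carrier K" if "g \<in> carrier G" "g' \<in> carrier G" for g g'
    using P.bichar_closed[OF that] V.R.Units_closed by blast
  note T_ab = T.abelian_group_axioms
  note W_simps = bilinear_map_simps[OF m] bilinear_map_simps[OF P.mul_bilinear]
    bilinear_map_simps[OF P.br_bilinear]
    linear_map_closed[OF P.alpha_linear] linear_map_closed[OF P.beta_linear]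
  note pure_simps = mul'_pure br'_pure \<alpha>'_pure \<beta>'_pure W_simps
  note closed = bilinear_map_simps(1)[OF mul'] bilinear_map_simps(1)[OF br']
    linear_map_closed[OF \<alpha>'] linear_map_closed[OF \<beta>']
  note linear = bilinear_map_simps(2-)[OF mul'] bilinear_map_simps(2-)[OF br']
    linear_map_add[OF \<alpha>'] linear_map_add[OF \<beta>'] linear_map_smult[OF \<alpha>'] linear_map_smult[OF \<beta>']
    bilinear_map_zero[OF T_ab T_ab T_ab mul'] bilinear_map_zero[OF T_ab T_ab T_ab br']
    linear_map_zero[OF T_ab T_ab \<alpha>'] linear_map_zero[OF T_ab T_ab \<beta>']
  have smult_commute: "k \<odot>\<^bsub>T\<^esub> (l \<odot>\<^bsub>T\<^esub> u) = l \<odot>\<^bsub>T\<^esub> (k \<odot>\<^bsub>T\<^esub> u)"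
    if "k \<in> carrier K" "l \<in> carrier K" "u \<in> carrier T" for k l u
    using that T.smult_assoc1[of k l u] T.smult_assoc1[of l k u] by (simp add: V.R.m_comm)
  note arith = closed linear T.smult_r_distr T.smult_r_minus T.minus_add T.a_ac smult_commute
  have smult_pure_right: "k \<odot>\<^bsub>T\<^esub> t v w = t v (k \<odot>\<^bsub>W\<^esub> w)"
    if "k \<in> carrier K" "v \<in> carrier V" "w \<in> carrier W" for k v w
    using that by (simp add: smult_pure pure_balanced)
  have minus_pure_right: "\<ominus>\<^bsub>T\<^esub> t v w = t v (\<ominus>\<^bsub>W\<^esub> w)"
    if "v \<in> carrier V" "w \<in> carrier W" for v w
    using linear_map_minus[OF W.abelian_group_axioms T_ab bilinear_map_linear(1)[OF pure_bilinear that(1)] that(2)]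
    by simp
  have even2: "f' u u' \<in> ?X (g \<otimes>\<^bsub>G\<^esub> g')"
    if f': "bilinear_map K T T T f'"
      and f'_pure: "\<And>a b x y. a \<in> carrier V \<Longrightarrow> b \<in> carrier V \<Longrightarrow> x \<in> carrier W \<Longrightarrow> y \<in> carrier W \<Longrightarrow>
        f' (t a x) (t b y) = t (m a b) (f x y)"
      and f: "\<And>x y. x \<in> gr g \<Longrightarrow> y \<in> gr g' \<Longrightarrow> f x y \<in> gr (g \<otimes>\<^bsub>G\<^esub> g')"
      and g: "g \<in> carrier G" "g' \<in> carrier G" and u: "u \<in> ?X g" and u': "u' \<in> ?X g'"
    for f f' g g' u u'
  proof -
    have gg: "g \<otimes>\<^bsub>G\<^esub> g' \<in> carrier G" using g by simp
    note f'_simps = bilinear_map_simps[OF f'] bilinear_map_zero[OF T_ab T_ab T_ab f']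
    have u'_T: "u' \<in> carrier T" by (rule X.gr_carrier[OF g(2) u'])
    show ?thesis
      using u gr[OF g(1)]
    proof (induction u rule: tensor_subspace_induct)
      case zero
      then show ?case using u'_T X.gr_zero[OF gg] by (simp add: f'_simps)
    next
      case (add a b)
      then show ?case using u'_T X.gr_add[OF gg] by (simp add: f'_simps)
    next
      case (pure a x)
      then have tax: "t a x \<in> carrier T" using grD[OF g(1)] by simp
      show ?case
        using u' gr[OF g(2)]
      proof (induction u' rule: tensor_subspace_induct)
        case zero
        then show ?case using tax X.gr_zero[OF gg] by (simp add: f'_simps)
      next
        case (add b c)
        then show ?case using tax X.gr_add[OF gg] by (simp add: f'_simps)
      next
        case (pure b y)
        then show ?case
          using \<open>a \<in> carrier V\<close> \<open>x \<in> gr g\<close> grD[OF g(1)] grD[OF g(2)] f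
          by (simp add: f'_pure W_simps pure_in_tensor_subspace)
      qed
    qed
  qed
  have even1: "f' u \<in> ?X g"
    if f': "linear_map K T T f'"
      and f'_pure: "\<And>a x. a \<in> carrier V \<Longrightarrow> x \<in> carrier W \<Longrightarrow> f' (t a x) = t a (f x)"
      and f: "\<And>x. x \<in> gr g \<Longrightarrow> f x \<in> gr g"
      and g: "g \<in> carrier G" and u: "u \<in> ?X g"
    for f f' g u
    using u gr[OF g]
  proof (induction u rule: tensor_subspace_induct)
    case zero
    then show ?case using X.gr_zero[OF g] by (simp add: linear_map_zero[OF T_ab T_ab f'])
  next
    case (add a b)
    then show ?case using X.gr_add[OF g] by (simp add: linear_map_add[OF f'])
  next
    case (pure a x)
    then show ?case using f grD[OF g] by (simp add: f'_pure pure_in_tensor_subspace)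
  qed
  have mult: "f' (b' u u') = b' (f' u) (f' u')"
    if b': "bilinear_map K T T T b'" and f': "linear_map K T T f'"
      and b'_pure: "\<And>a c x y. a \<in> carrier V \<Longrightarrow> c \<in> carrier V \<Longrightarrow> x \<in> carrier W \<Longrightarrow> y \<in> carrier W \<Longrightarrow>
        b' (t a x) (t c y) = t (m a c) (b x y)"
      and f'_pure: "\<And>a x. a \<in> carrier V \<Longrightarrow> x \<in> carrier W \<Longrightarrow> f' (t a x) = t a (f x)"
      and b: "\<And>x y. x \<in> carrier W \<Longrightarrow> y \<in> carrier W \<Longrightarrow> b x y \<in> carrier W"
      and f: "\<And>x. x \<in> carrier W \<Longrightarrow> f x \<in> carrier W"
      and fb: "\<And>x y. x \<in> carrier W \<Longrightarrow> y \<in> carrier W \<Longrightarrow> f (b x y) = b (f x) (f y)"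
      and u: "u \<in> carrier T" "u' \<in> carrier T"
    for b b' f f' u u'
  proof (rule bilinear_map_eq_on_subspaces[OF T_ab, where f = "\<lambda>u u'. f' (b' u u')" and
        g = "\<lambda>u u'. b' (f' u) (f' u')" and S = "carrier W" and S' = "carrier W"])
    note simps = bilinear_map_simps[OF b'] linear_map_closed[OF f'] linear_map_add[OF f'] linear_map_smult[OF f']
    show "bilinear_map K T T T (\<lambda>u u'. f' (b' u u'))"
      by (rule bilinear_mapI) (simp_all add: simps)
    show "bilinear_map K T T T (\<lambda>u u'. b' (f' u) (f' u'))"
      by (rule bilinear_mapI) (simp_all add: simps)
  qed (use u in \<open>simp_all add: tensor_subspace_carrier b'_pure f'_pure b f fb W_simps\<close>)
  show ?thesis
  proof (intro bihom_poisson_color_algebra.intro bihom_poisson_color_algebra_axioms.intro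
      mul' br' \<alpha>' \<beta>' X.graded_vector_space_axioms P.skew_symmetric_bicharacter_axioms)
    fix u u' assume u: "u \<in> carrier T" and u': "u' \<in> carrier T"
    show "\<alpha>' (mul' u u') = mul' (\<alpha>' u) (\<alpha>' u')"
      by (rule mult[OF mul' \<alpha>' mul'_pure \<alpha>'_pure _ _ _ u u']) (simp_all add: W_simps P.alpha_mul)
    show "\<beta>' (mul' u u') = mul' (\<beta>' u) (\<beta>' u')"
      by (rule mult[OF mul' \<beta>' mul'_pure \<beta>'_pure _ _ _ u u']) (simp_all add: W_simps P.beta_mul)
    show "\<alpha>' (br' u u') = br' (\<alpha>' u) (\<alpha>' u')"
      by (rule mult[OF br' \<alpha>' br'_pure \<alpha>'_pure _ _ _ u u']) (simp_all add: W_simps P.alpha_br)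
    show "\<beta>' (br' u u') = br' (\<beta>' u) (\<beta>' u')"
      by (rule mult[OF br' \<beta>' br'_pure \<beta>'_pure _ _ _ u u']) (simp_all add: W_simps P.beta_br)
    show "\<alpha>' (\<beta>' u) = \<beta>' (\<alpha>' u)"
      using u by (induction u rule: tensor_induct)
        (simp_all add: linear closed pure_simps P.alpha_beta_commute)
  next
    fix g g' u u'
    assume g: "g \<in> carrier G" "g' \<in> carrier G" and u: "u \<in> ?X g" "u' \<in> ?X g'"
    show "mul' u u' \<in> ?X (g \<otimes>\<^bsub>G\<^esub> g')"
      by (rule even2[OF mul' mul'_pure _ g u]) (simp_all add: P.mul_even g)
    show "br' u u' \<in> ?X (g \<otimes>\<^bsub>G\<^esub> g')"
      by (rule even2[OF br' br'_pure _ g u]) (simp_all add: P.br_even g)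
    show "br' (\<beta>' u) (\<alpha>' u') = \<ominus>\<^bsub>T\<^esub> (\<epsilon> g g' \<odot>\<^bsub>T\<^esub> br' (\<beta>' u') (\<alpha>' u))"
    proof (rule bilinear_map_eq_on_subspaces[OF T_ab _ _ gr[OF g(1)] gr[OF g(2)] _ u])
      show "bilinear_map K T T T (\<lambda>u u'. br' (\<beta>' u) (\<alpha>' u'))"
        by (rule bilinear_mapI) (simp_all add: arith)
      show "bilinear_map K T T T (\<lambda>u u'. \<ominus>\<^bsub>T\<^esub> (\<epsilon> g g' \<odot>\<^bsub>T\<^esub> br' (\<beta>' u') (\<alpha>' u)))"
        by (rule bilinear_mapI) (simp_all add: arith \<epsilon> g)
      fix a x b y
      assume ab: "a \<in> carrier V" "b \<in> carrier V" and x: "x \<in> gr g" and y: "y \<in> gr g'"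
      note xy = grD[OF g(1) x] grD[OF g(2) y]
      have "br' (\<beta>' (t a x)) (\<alpha>' (t b y)) = t (m a b) (br (\<beta> x) (\<alpha> y))"
        using ab xy by (simp add: pure_simps)
      also have "br (\<beta> x) (\<alpha> y) = \<ominus>\<^bsub>W\<^esub> (\<epsilon> g g' \<odot>\<^bsub>W\<^esub> br (\<beta> y) (\<alpha> x))"
        by (rule P.bihom_skew[OF g x y])
      also have "m a b = m b a" by (rule m_comm[OF ab])
      also have "t (m b a) (\<ominus>\<^bsub>W\<^esub> (\<epsilon> g g' \<odot>\<^bsub>W\<^esub> br (\<beta> y) (\<alpha> x))) =
          \<ominus>\<^bsub>T\<^esub> (\<epsilon> g g' \<odot>\<^bsub>T\<^esub> br' (\<beta>' (t b y)) (\<alpha>' (t a x)))"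
        using ab xy g \<epsilon> by (simp add: pure_simps smult_pure_right minus_pure_right)
      finally show "br' (\<beta>' (t a x)) (\<alpha>' (t b y)) =
        \<ominus>\<^bsub>T\<^esub> (\<epsilon> g g' \<odot>\<^bsub>T\<^esub> br' (\<beta>' (t b y)) (\<alpha>' (t a x)))" .
    qed
  next
    fix g u
    assume g: "g \<in> carrier G" and u: "u \<in> ?X g"
    show "\<alpha>' u \<in> ?X g"
      by (rule even1[OF \<alpha>' \<alpha>'_pure _ g u]) (simp_all add: P.alpha_even g)
    show "\<beta>' u \<in> ?X g"
      by (rule even1[OF \<beta>' \<beta>'_pure _ g u]) (simp_all add: P.beta_even g)
  next
    fix g g' g'' u u' u''
    assume g: "g \<in> carrier G" "g' \<in> carrier G" "g'' \<in> carrier G"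
      and u: "u \<in> ?X g" "u' \<in> ?X g'" "u'' \<in> ?X g''"
    note grs = gr[OF g(1)] gr[OF g(2)] gr[OF g(3)]
    show "mul' (\<alpha>' u) (mul' u' u'') = mul' (mul' u u') (\<beta>' u'')"
    proof (rule trilinear_map_eq_on_subspaces[OF T_ab _ _ grs _ u])
      show "trilinear_map K T T (\<lambda>u u' u''. mul' (\<alpha>' u) (mul' u' u''))"
        by (simp add: trilinear_map_def bilinear_map_def linear_map_def arith)
      show "trilinear_map K T T (\<lambda>u u' u''. mul' (mul' u u') (\<beta>' u''))"
        by (simp add: trilinear_map_def bilinear_map_def linear_map_def arith)
      fix a x b y c z
      assume "a \<in> carrier V" "b \<in> carrier V" "c \<in> carrier V" "x \<in> gr g" "y \<in> gr g'" "z \<in> gr g''"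
      then show "mul' (\<alpha>' (t a x)) (mul' (t b y) (t c z)) = mul' (mul' (t a x) (t b y)) (\<beta>' (t c z))"
        using grD g P.bihom_assoc[OF g] by (simp add: pure_simps m_assoc)
    qed
    show "\<epsilon> g'' g \<odot>\<^bsub>T\<^esub> br' (\<beta>' (\<beta>' u)) (br' (\<beta>' u') (\<alpha>' u'')) \<oplus>\<^bsub>T\<^esub>
      \<epsilon> g g' \<odot>\<^bsub>T\<^esub> br' (\<beta>' (\<beta>' u')) (br' (\<beta>' u'') (\<alpha>' u)) \<oplus>\<^bsub>T\<^esub>
      \<epsilon> g' g'' \<odot>\<^bsub>T\<^esub> br' (\<beta>' (\<beta>' u'')) (br' (\<beta>' u) (\<alpha>' u')) = \<zero>\<^bsub>T\<^esub>"
    proof (rule trilinear_map_eq_on_subspaces[OF T_ab _ _ grs _ u])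
      show "trilinear_map K T T (\<lambda>u u' u''.
        \<epsilon> g'' g \<odot>\<^bsub>T\<^esub> br' (\<beta>' (\<beta>' u)) (br' (\<beta>' u') (\<alpha>' u'')) \<oplus>\<^bsub>T\<^esub>
        \<epsilon> g g' \<odot>\<^bsub>T\<^esub> br' (\<beta>' (\<beta>' u')) (br' (\<beta>' u'') (\<alpha>' u)) \<oplus>\<^bsub>T\<^esub>
        \<epsilon> g' g'' \<odot>\<^bsub>T\<^esub> br' (\<beta>' (\<beta>' u'')) (br' (\<beta>' u) (\<alpha>' u')))"
        using \<epsilon>[OF g(3,1)] \<epsilon>[OF g(1,2)] \<epsilon>[OF g(2,3)]
        by (simp add: trilinear_map_def bilinear_map_def linear_map_def arith)
      show "trilinear_map K T T (\<lambda>u u' u''. \<zero>\<^bsub>T\<^esub>)"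
        by (simp add: trilinear_map_def bilinear_map_def linear_map_def)
      fix a x b y c z
      assume abc: "a \<in> carrier V" "b \<in> carrier V" "c \<in> carrier V"
        and x: "x \<in> gr g" and y: "y \<in> gr g'" and z: "z \<in> gr g''"
      note xyz = grD[OF g(1) x] grD[OF g(2) y] grD[OF g(3) z]
      \<comment> \<open>The common coefficient of the three cyclic terms.\<close>
      define n where "n = m a (m b c)"
      have n: "n \<in> carrier V" "m b (m c a) = n" "m c (m a b) = n"
        using abc m_comm[of a "m b c"] m_comm[of c "m a b"]
        by (simp_all add: n_def W_simps m_assoc)
      have "\<epsilon> g'' g \<odot>\<^bsub>T\<^esub> br' (\<beta>' (\<beta>' (t a x))) (br' (\<beta>' (t b y)) (\<alpha>' (t c z))) \<oplus>\<^bsub>T\<^esub>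
        \<epsilon> g g' \<odot>\<^bsub>T\<^esub> br' (\<beta>' (\<beta>' (t b y))) (br' (\<beta>' (t c z)) (\<alpha>' (t a x))) \<oplus>\<^bsub>T\<^esub>
        \<epsilon> g' g'' \<odot>\<^bsub>T\<^esub> br' (\<beta>' (\<beta>' (t c z))) (br' (\<beta>' (t a x)) (\<alpha>' (t b y))) =
        t n (\<epsilon> g'' g \<odot>\<^bsub>W\<^esub> br (\<beta> (\<beta> x)) (br (\<beta> y) (\<alpha> z)) \<oplus>\<^bsub>W\<^esub>
        \<epsilon> g g' \<odot>\<^bsub>W\<^esub> br (\<beta> (\<beta> y)) (br (\<beta> z) (\<alpha> x)) \<oplus>\<^bsub>W\<^esub>
        \<epsilon> g' g'' \<odot>\<^bsub>W\<^esub> br (\<beta> (\<beta> z)) (br (\<beta> x) (\<alpha> y)))"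
        using abc xyz \<epsilon>[OF g(3,1)] \<epsilon>[OF g(1,2)] \<epsilon>[OF g(2,3)] n
        by (simp add: pure_simps smult_pure_right pure_add_right flip: n_def)
      also have "\<dots> = \<zero>\<^bsub>T\<^esub>"
        by (simp only: P.bihom_jacobi[OF g x y z] pure_zero_right[OF n(1)])
      finally show "\<epsilon> g'' g \<odot>\<^bsub>T\<^esub> br' (\<beta>' (\<beta>' (t a x))) (br' (\<beta>' (t b y)) (\<alpha>' (t c z))) \<oplus>\<^bsub>T\<^esub>
        \<epsilon> g g' \<odot>\<^bsub>T\<^esub> br' (\<beta>' (\<beta>' (t b y))) (br' (\<beta>' (t c z)) (\<alpha>' (t a x))) \<oplus>\<^bsub>T\<^esub>
        \<epsilon> g' g'' \<odot>\<^bsub>T\<^esub> br' (\<beta>' (\<beta>' (t c z))) (br' (\<beta>' (t a x)) (\<alpha>' (t b y))) = \<zero>\<^bsub>T\<^esub>" .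
    qed
    show "br' (\<alpha>' (\<beta>' u)) (mul' u' u'') =
      mul' (br' (\<beta>' u) u') (\<beta>' u'') \<oplus>\<^bsub>T\<^esub> \<epsilon> g g' \<odot>\<^bsub>T\<^esub> mul' (\<beta>' u') (br' (\<alpha>' u) u'')"
    proof (rule trilinear_map_eq_on_subspaces[OF T_ab _ _ grs _ u])
      show "trilinear_map K T T (\<lambda>u u' u''. br' (\<alpha>' (\<beta>' u)) (mul' u' u''))"
        by (simp add: trilinear_map_def bilinear_map_def linear_map_def arith)
      show "trilinear_map K T T (\<lambda>u u' u''.
        mul' (br' (\<beta>' u) u') (\<beta>' u'') \<oplus>\<^bsub>T\<^esub> \<epsilon> g g' \<odot>\<^bsub>T\<^esub> mul' (\<beta>' u') (br' (\<alpha>' u) u''))"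
        using \<epsilon>[OF g(1,2)] by (simp add: trilinear_map_def bilinear_map_def linear_map_def arith)
      fix a x b y c z
      assume abc: "a \<in> carrier V" "b \<in> carrier V" "c \<in> carrier V"
        and x: "x \<in> gr g" and y: "y \<in> gr g'" and z: "z \<in> gr g''"
      note xyz = grD[OF g(1) x] grD[OF g(2) y] grD[OF g(3) z]
      have n: "m (m a b) c = m a (m b c)" "m b (m a c) = m a (m b c)"
        using abc m_comm[of a b] m_assoc[of a b c] m_assoc[of b a c] by simp_all
      show "br' (\<alpha>' (\<beta>' (t a x))) (mul' (t b y) (t c z)) =
        mul' (br' (\<beta>' (t a x)) (t b y)) (\<beta>' (t c z)) \<oplus>\<^bsub>T\<^esub>
        \<epsilon> g g' \<odot>\<^bsub>T\<^esub> mul' (\<beta>' (t b y)) (br' (\<alpha>' (t a x)) (t c z))"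
        using abc xyz \<epsilon>[OF g(1,2)] P.bihom_leibniz[OF g x y z]
        by (simp add: pure_simps smult_pure_right n pure_add_right)
    qed
  qed
qed

section \<open>Extension of scalars\<close>

lemma restrict_scalars_module:
  assumes "cring K" and "cring L" and h: "h \<in> ring_hom K L"
  shows "module K (restrict_scalars L h)"
    and "bilinear_map K (restrict_scalars L h) (restrict_scalars L h) (restrict_scalars L h) (\<otimes>\<^bsub>L\<^esub>)"
proof -
  interpret K: cring K by fact
  interpret L: cring L by fact
  note h_simps = ring_hom_closed[OF h] ring_hom_add[OF h] ring_hom_mult[OF h] ring_hom_one[OF h]
  have "abelian_group (restrict_scalars L h)"
    by (rule abelian_groupI) (auto simp: restrict_scalars_def L.a_ac intro: L.add.l_inv_ex)
  then show "module K (restrict_scalars L h)"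
    by (intro moduleI K.cring_axioms)
      (simp_all add: restrict_scalars_def h_simps L.l_distr L.r_distr L.m_ac)
  show "bilinear_map K (restrict_scalars L h) (restrict_scalars L h) (restrict_scalars L h) (\<otimes>\<^bsub>L\<^esub>)"
    by (rule bilinear_mapI)
      (simp_all add: restrict_scalars_def h_simps L.l_distr L.r_distr L.m_ac)
qed

theorem theorem3p6:
  fixes K :: "('k, 'a) ring_scheme" and L :: "('l, 'b) ring_scheme" and h :: "'k \<Rightarrow> 'l"
    and G :: "('g, 'c) monoid_scheme" and P :: "('k, 'p, 'd) module_scheme"
    and gr :: "'g \<Rightarrow> 'p set" and \<epsilon> :: "'g \<Rightarrow> 'g \<Rightarrow> 'k"
    and mul br :: "'p \<Rightarrow> 'p \<Rightarrow> 'p" and \<alpha> \<beta> :: "'p \<Rightarrow> 'p"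
  assumes "field K" and "\<one>\<^bsub>K\<^esub> \<oplus>\<^bsub>K\<^esub> \<one>\<^bsub>K\<^esub> \<noteq> \<zero>\<^bsub>K\<^esub>"
    and "field L" and "h \<in> ring_hom K L"
    and "comm_group G"
    and "bihom_poisson_color_algebra K G P gr \<epsilon> mul br \<alpha> \<beta>"
  shows "(\<exists>mul' br' \<alpha>' \<beta>'.
      extended_operations K L h G P gr mul br \<alpha> \<beta> mul' br' \<alpha>' \<beta>' \<and>
      bihom_poisson_color_algebra K G (scalar_extension K L h P) (ext_grading K L h P gr) \<epsilon>
        mul' br' \<alpha>' \<beta>' \<and>
      (\<forall>mul'' br'' \<alpha>'' \<beta>''.
        extended_operations K L h G P gr mul br \<alpha> \<beta> mul'' br'' \<alpha>'' \<beta>'' \<longrightarrow>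
        (\<forall>u\<in>carrier (scalar_extension K L h P). \<forall>v\<in>carrier (scalar_extension K L h P).
          mul'' u v = mul' u v \<and> br'' u v = br' u v \<and> \<alpha>'' u = \<alpha>' u \<and> \<beta>'' u = \<beta>' u))) \<and>
    (\<forall>g\<in>carrier G. \<exists>\<phi>.
      linear_map K (scalar_extension K L h (P\<lparr>carrier := gr g\<rparr>)) (scalar_extension K L h P) \<phi> \<and>
      bij_betw \<phi> (carrier (scalar_extension K L h (P\<lparr>carrier := gr g\<rparr>))) (ext_grading K L h P gr g) \<and>
      (\<forall>r\<in>carrier L. \<forall>x\<in>gr g.
        \<phi> (ext_tensor K L h (P\<lparr>carrier := gr g\<rparr>) r x) = ext_tensor K L h P r x))"
proof -
  interpret K: field K by fact
  interpret L: field L by fact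
  interpret P: bihom_poisson_color_algebra K G P gr \<epsilon> mul br \<alpha> \<beta> by fact
  let ?R = "restrict_scalars L h"
  have R_carrier: "carrier ?R = carrier L"
    by (simp add: restrict_scalars_def)
  note R = restrict_scalars_module[OF K.is_cring L.is_cring \<open>h \<in> ring_hom K L\<close>]
  interpret R: module K ?R by (rule R(1))
  interpret RP: module_pair K ?R P ..
  obtain mul' where mul': "bilinear_map K RP.T RP.T RP.T mul'"
    and mul'_pure: "\<And>r x s y. r \<in> carrier L \<Longrightarrow> x \<in> carrier P \<Longrightarrow> s \<in> carrier L \<Longrightarrow> y \<in> carrier P \<Longrightarrow>
      mul' (RP.t r x) (RP.t s y) = RP.t (r \<otimes>\<^bsub>L\<^esub> s) (mul x y)"
    using RP.tensor_bilinear_map[OF R(2) P.mul_bilinear] unfolding R_carrier by blast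
  obtain br' where br': "bilinear_map K RP.T RP.T RP.T br'"
    and br'_pure: "\<And>r x s y. r \<in> carrier L \<Longrightarrow> x \<in> carrier P \<Longrightarrow> s \<in> carrier L \<Longrightarrow> y \<in> carrier P \<Longrightarrow>
      br' (RP.t r x) (RP.t s y) = RP.t (r \<otimes>\<^bsub>L\<^esub> s) (br x y)"
    using RP.tensor_bilinear_map[OF R(2) P.br_bilinear] unfolding R_carrier by blast
  obtain \<alpha>' where \<alpha>': "linear_map K RP.T RP.T \<alpha>'"
    and \<alpha>'_pure: "\<And>r x. r \<in> carrier L \<Longrightarrow> x \<in> carrier P \<Longrightarrow> \<alpha>' (RP.t r x) = RP.t r (\<alpha> x)"
    using RP.tensor_linear_map[OF P.V.module_axioms P.alpha_linear] unfolding R_carrier by blast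
  obtain \<beta>' where \<beta>': "linear_map K RP.T RP.T \<beta>'"
    and \<beta>'_pure: "\<And>r x. r \<in> carrier L \<Longrightarrow> x \<in> carrier P \<Longrightarrow> \<beta>' (RP.t r x) = RP.t r (\<beta> x)"
    using RP.tensor_linear_map[OF P.V.module_axioms P.beta_linear] unfolding R_carrier by blast
  have ext: "extended_operations K L h G P gr mul br \<alpha> \<beta> mul' br' \<alpha>' \<beta>'"
    unfolding extended_operations_def Let_def
    using mul' br' \<alpha>' \<beta>' P.gr_carrier
    by (simp add: mul'_pure br'_pure \<alpha>'_pure \<beta>'_pure)
  have algebra: "bihom_poisson_color_algebra K G RP.T (ext_grading K L h P gr) \<epsilon> mul' br' \<alpha>' \<beta>'"
    by (rule RP.tensor_bihom_poisson_color_algebra[OF R(2) _ _ P.bihom_poisson_color_algebra_axioms mul' br' \<alpha>' \<beta>'])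
      (simp_all add: R_carrier L.m_ac mul'_pure br'_pure \<alpha>'_pure \<beta>'_pure)
  note eqI = RP.linear_map_eq_on_homogeneous_pure[OF P.graded_vector_space_axioms RP.tensor_module,
      unfolded R_carrier]
  have bilinear_unique: "b'' u v = b' u v"
    if b': "bilinear_map K RP.T RP.T RP.T b'" and b'': "bilinear_map K RP.T RP.T RP.T b''"
      and eq: "\<And>r s g g' x y. r \<in> carrier L \<Longrightarrow> s \<in> carrier L \<Longrightarrow> g \<in> carrier G \<Longrightarrow> g' \<in> carrier G \<Longrightarrow>
        x \<in> gr g \<Longrightarrow> y \<in> gr g' \<Longrightarrow> b'' (RP.t r x) (RP.t s y) = b' (RP.t r x) (RP.t s y)"
      and u: "u \<in> carrier RP.T" and v: "v \<in> carrier RP.T" for b' b'' u v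
  proof (rule eqI[OF bilinear_map_linear(1)[OF b'' u] bilinear_map_linear(1)[OF b' u] _ v])
    fix g s y assume s: "g \<in> carrier G" "s \<in> carrier L" "y \<in> gr g"
    then have sy: "RP.t s y \<in> carrier RP.T"
      using P.gr_carrier by (simp add: R_carrier RP.pure_closed)
    show "b'' u (RP.t s y) = b' u (RP.t s y)"
      by (rule eqI[OF bilinear_map_linear(2)[OF b'' sy] bilinear_map_linear(2)[OF b' sy] _ u])
        (rule eq; use s in blast)
  qed
  have unique: "mul'' u v = mul' u v \<and> br'' u v = br' u v \<and> \<alpha>'' u = \<alpha>' u \<and> \<beta>'' u = \<beta>' u"
    if ext'': "extended_operations K L h G P gr mul br \<alpha> \<beta> mul'' br'' \<alpha>'' \<beta>''"
      and u: "u \<in> carrier RP.T" and v: "v \<in> carrier RP.T" for mul'' br'' \<alpha>'' \<beta>'' u v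
  proof -
    have lin: "bilinear_map K RP.T RP.T RP.T mul''" "bilinear_map K RP.T RP.T RP.T br''"
      "linear_map K RP.T RP.T \<alpha>''" "linear_map K RP.T RP.T \<beta>''"
      and pure2: "\<And>r s g g' x y. r \<in> carrier L \<Longrightarrow> s \<in> carrier L \<Longrightarrow> g \<in> carrier G \<Longrightarrow> g' \<in> carrier G \<Longrightarrow>
        x \<in> gr g \<Longrightarrow> y \<in> gr g' \<Longrightarrow> mul'' (RP.t r x) (RP.t s y) = RP.t (r \<otimes>\<^bsub>L\<^esub> s) (mul x y) \<and>
          br'' (RP.t r x) (RP.t s y) = RP.t (r \<otimes>\<^bsub>L\<^esub> s) (br x y)"
      and pure1: "\<And>r g x. r \<in> carrier L \<Longrightarrow> g \<in> carrier G \<Longrightarrow> x \<in> gr g \<Longrightarrow>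
        \<alpha>'' (RP.t r x) = RP.t r (\<alpha> x) \<and> \<beta>'' (RP.t r x) = RP.t r (\<beta> x)"
      using ext'' unfolding extended_operations_def Let_def by blast+
    have "mul'' u v = mul' u v"
      by (rule bilinear_unique[OF mul' lin(1) _ u v])
        (simp add: pure2 mul'_pure P.gr_carrier)
    moreover have "br'' u v = br' u v"
      by (rule bilinear_unique[OF br' lin(2) _ u v])
        (simp add: pure2 br'_pure P.gr_carrier)
    moreover have "\<alpha>'' u = \<alpha>' u"
      by (rule eqI[OF lin(3) \<alpha>' _ u]) (simp add: pure1 \<alpha>'_pure P.gr_carrier)
    moreover have "\<beta>'' u = \<beta>' u"
      by (rule eqI[OF lin(4) \<beta>' _ u]) (simp add: pure1 \<beta>'_pure P.gr_carrier)
    ultimately show ?thesis by blast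
  qed
  obtain p where p: "grading_projections K G P gr p"
    by (rule P.grading_projections_exist)
  have summand: "\<exists>\<phi>.
      linear_map K (scalar_extension K L h (P\<lparr>carrier := gr g\<rparr>)) (scalar_extension K L h P) \<phi> \<and>
      bij_betw \<phi> (carrier (scalar_extension K L h (P\<lparr>carrier := gr g\<rparr>))) (ext_grading K L h P gr g) \<and>
      (\<forall>r\<in>carrier L. \<forall>x\<in>gr g.
        \<phi> (ext_tensor K L h (P\<lparr>carrier := gr g\<rparr>) r x) = ext_tensor K L h P r x)"
    if g: "g \<in> carrier G" for g
    using RP.tensor_of_summand[OF P.gr_subspace[OF g], of "p g"] p g
    unfolding grading_projections_def R_carrier by blast
  show ?thesis
  proof (rule conjI)
    show "\<exists>mul' br' \<alpha>' \<beta>'.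
      extended_operations K L h G P gr mul br \<alpha> \<beta> mul' br' \<alpha>' \<beta>' \<and>
      bihom_poisson_color_algebra K G RP.T (ext_grading K L h P gr) \<epsilon> mul' br' \<alpha>' \<beta>' \<and>
      (\<forall>mul'' br'' \<alpha>'' \<beta>''.
        extended_operations K L h G P gr mul br \<alpha> \<beta> mul'' br'' \<alpha>'' \<beta>'' \<longrightarrow>
        (\<forall>u\<in>carrier RP.T. \<forall>v\<in>carrier RP.T.
          mul'' u v = mul' u v \<and> br'' u v = br' u v \<and> \<alpha>'' u = \<alpha>' u \<and> \<beta>'' u = \<beta>' u))"
      by (rule exI[of _ mul'], rule exI[of _ br'], rule exI[of _ \<alpha>'], rule exI[of _ \<beta>'])
        (intro conjI allI impI ballI ext algebra; drule (2) unique; elim conjE; assumption)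
  qed (rule ballI, rule summand)
qed

end
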